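(* For every integer $h\ge 2$, there exist disjoint sets $A,B\subseteq\mathbb{N}_0$ with $A\cup B=\mathbb{N}_0$ such that $A$ is a minimal asymptotic basis of order $h$ and $B$ is a maximal asymptotic nonbasis of order $h$.
   Context: $\mathbb{N}_0=\{0,1,2,\ldots\}$. For an integer $h\ge2$ and a set $A\subseteq\mathbb{N}_0$, $hA=\{a_1+\cdots+a_h : a_1,\ldots,a_h\in A\}$ (the summands need not be distinct). A set $A\subseteq\mathbb{N}_0$ is an asymptotic basis of order $h$ if every sufficiently large integer belongs to $hA$; otherwise $A$ is an asymptotic nonbasis of order $h$. An asymptotic basis $A$ of order $h$ is minimal if $A\setminus\{a\}$ is not an asymptotic basis of order $h$ for every $a\in A$. An asymptotic nonbasis $B$ of order $h$ is maximal if $B\cup\{b\}$ is an asymptotic basis of order $h$ for every nonnegative integer $b\notin B$. *)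

theory Defs
  imports Main
begin

definition sumset :: "nat \<Rightarrow> nat set \<Rightarrow> nat set" where
  "sumset h A = {\<Sum>i<h. a i | a. \<forall>i<h. a i \<in> A}"

definition asymptotic_basis :: "nat \<Rightarrow> nat set \<Rightarrow> bool" where
  "asymptotic_basis h A \<longleftrightarrow> (\<exists>N. \<forall>n\<ge>N. n \<in> sumset h A)"

definition asymptotic_nonbasis :: "nat \<Rightarrow> nat set \<Rightarrow> bool" where
  "asymptotic_nonbasis h A \<longleftrightarrow> \<not> asymptotic_basis h A"

definition minimal_asymptotic_basis :: "nat \<Rightarrow> nat set \<Rightarrow> bool" where
  "minimal_asymptotic_basis h A \<longleftrightarrow>
     asymptotic_basis h A \<and> (\<forall>a\<in>A. \<not> asymptotic_basis h (A - {a}))"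

definition maximal_asymptotic_nonbasis :: "nat \<Rightarrow> nat set \<Rightarrow> bool" where
  "maximal_asymptotic_nonbasis h B \<longleftrightarrow>
     asymptotic_nonbasis h B \<and> (\<forall>b. b \<notin> B \<longrightarrow> asymptotic_basis h (B \<union> {b}))"

end

theory Submission
  imports Defs "HOL-Library.Nat_Bijection"
begin

text \<open>The two sets are built in stages, each of which extends a partition of an initial segment \<open>{..N}\<close> to a
much longer one.  In every stage one of the two sets is continued \<^emph>\<open>sparsely\<close>, and the other receives
nearly all remaining integers; from stage to stage the roles alternate.  The sparse continuation \<open>Y'\<close>
represents every integer in its range as a sum of \<open>h\<close> elements, except for a single \<^emph>\<open>hole\<close> \<open>n\<close>.  The hole
comes with a prescribed set \<open>F\<close> of critical elements: no representation of \<open>n\<close> avoids \<open>F\<close>, and each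
\<open>f\<close> in \<open>F\<close> yields one, because \<open>n - f\<close> is a sum of \<open>h - 1\<close> elements of \<open>Y'\<close> (lemma
\<open>exists_next_stage\<close>).

Critical elements may be chosen inside or outside the sparse set, and this gives both halves of the
theorem.  When \<open>A\<close> is sparse, \<open>F = {a}\<close> with \<open>a\<close> in \<open>A\<close>: the hole is represented by \<open>A\<close> but not
by \<open>A - {a}\<close>.  If every \<open>a\<close> gets its turn infinitely often, \<open>A\<close> is a minimal basis.  When \<open>B\<close> is
sparse, \<open>F\<close> consists of the elements up to \<open>t\<close> of \<open>A\<close>: the hole is not represented by \<open>B\<close>, but it is
represented by \<open>B \<union> {a}\<close> for every such \<open>a\<close>.  As \<open>t\<close> grows, \<open>B\<close> becomes a maximal nonbasis.

The sparse continuation imitates a number system with \<open>h\<close> digits.  Its first digit is a block of \<open>L\<close>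
consecutive integers already present, the others are arithmetic progressions with \<open>K\<close> terms and
differences \<open>L\<close>, \<open>L * K\<close>, \<dots>, \<open>L * K ^ (h - 2)\<close>.  Taking one element of each kind represents exactly
an interval of \<open>L * K ^ (h - 1)\<close> integers, and the first integer after it is the hole.  Other
combinations could represent the hole only by using some progression at least twice.  To prevent
this, the progressions start at generic points.  The point is a count of residues: a sum of \<open>h\<close>
elements that uses the last progression twice has only \<open>h - 2\<close> further summands, drawn from a set of
order \<open>K\<close>, so such sums occupy order \<open>K ^ (h - 2)\<close> classes modulo \<open>L * K ^ (h - 2)\<close>; for a large
constant \<open>L\<close> there is room to avoid them (lemmas \<open>progression_keeps_exact_end\<close> and \<open>ladder_exists\<close>).
The critical elements are attached by a generic marker \<open>u\<close> and the markers \<open>v - f\<close> for \<open>f\<close> in \<open>F\<close>,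
where \<open>n = (h - 2) * u + v\<close>.  The same count shows that they create no representation of \<open>n\<close> other than
\<open>n = (h - 2) * u + (v - f) + f\<close> (lemma \<open>hole_survives_markers\<close>).

The set that is not sparse causes no trouble.  It misses only a bounded number of integers in each window
of length \<open>L\<close>, so a pigeonhole argument finds sums of two of its elements everywhere (lemma
\<open>full_side_covers\<close>).\<close>

section \<open>Sums of a fixed number of elements\<close>

lemma sumset_0 [simp]: "sumset 0 A = {0}"
  by (auto simp: sumset_def)

lemma sumset_Suc: "sumset (Suc h) A = {a + s | a s. a \<in> A \<and> s \<in> sumset h A}"
proof (intro equalityI subsetI)
  fix z assume "z \<in> sumset (Suc h) A"
  then obtain a where "\<forall>i<Suc h. a i \<in> A" "z = (\<Sum>i<Suc h. a i)"
    by (auto simp: sumset_def)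
  then have "z = a h + (\<Sum>i<h. a i)" "a h \<in> A" "(\<Sum>i<h. a i) \<in> sumset h A"
    by (auto simp: sumset_def)
  then show "z \<in> {a + s | a s. a \<in> A \<and> s \<in> sumset h A}"
    by blast
next
  fix z assume "z \<in> {a + s | a s. a \<in> A \<and> s \<in> sumset h A}"
  then obtain b a where b: "b \<in> A" and a: "\<forall>i<h. a i \<in> A" and z: "z = b + (\<Sum>i<h. a i)"
    by (auto simp: sumset_def)
  have "z = (\<Sum>i<Suc h. (a(h := b)) i)"
    using z by simp
  moreover have "\<forall>i<Suc h. (a(h := b)) i \<in> A"
    using a b by (simp add: less_Suc_eq)
  ultimately show "z \<in> sumset (Suc h) A"
    unfolding sumset_def by blast
qed

lemma sumset_SucI: "a \<in> A \<Longrightarrow> s \<in> sumset h A \<Longrightarrow> a + s \<in> sumset (Suc h) A"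
  by (auto simp: sumset_Suc)

lemma sumset_1 [simp]: "sumset (Suc 0) A = A"
  by (auto simp: sumset_Suc)

lemma sumset_mono: "A \<subseteq> B \<Longrightarrow> sumset h A \<subseteq> sumset h B"
  by (induction h) (auto simp: sumset_Suc)

lemma sumset_add:
  "x \<in> sumset i A \<Longrightarrow> y \<in> sumset j A \<Longrightarrow> x + y \<in> sumset (i + j) A"
proof (induction i arbitrary: x)
  case (Suc i)
  then obtain a s where "a \<in> A" "s \<in> sumset i A" "x = a + s"
    by (auto simp: sumset_Suc)
  with Suc show ?case
    using sumset_SucI[of a A "s + y" "i + j"] by (simp add: add.assoc)
qed simp

lemma sumset_mult: "a \<in> A \<Longrightarrow> i * a \<in> sumset i A"
  by (induction i) (auto simp: sumset_Suc)

lemma sumset_le: "\<forall>a\<in>A. a \<le> m \<Longrightarrow> z \<in> sumset h A \<Longrightarrow> z \<le> h * m"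
  by (induction h arbitrary: z) (fastforce simp: sumset_Suc intro: add_mono)+

lemma sumset_ge: "\<forall>a\<in>A. m \<le> a \<Longrightarrow> z \<in> sumset h A \<Longrightarrow> h * m \<le> z"
  by (induction h arbitrary: z) (fastforce simp: sumset_Suc intro: add_mono)+

text \<open>Every case analysis below runs on the number of summands that come from a given part of the set.\<close>

lemma sumset_Un:
  assumes "z \<in> sumset h (A \<union> B)"
  obtains c p q where "c \<le> h" "p \<in> sumset (h - c) A" "q \<in> sumset c B" "z = p + q"
proof -
  have "\<exists>c p q. c \<le> h \<and> p \<in> sumset (h - c) A \<and> q \<in> sumset c B \<and> z = p + q"
    using assms
  proof (induction h arbitrary: z)
    case (Suc h)
    then obtain a s where a: "a \<in> A \<union> B" and s: "s \<in> sumset h (A \<union> B)" and z: "z = a + s"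
      by (auto simp: sumset_Suc)
    obtain c p q where cpq: "c \<le> h" "p \<in> sumset (h - c) A" "q \<in> sumset c B" "s = p + q"
      using Suc.IH[OF s] by blast
    from a show ?case
    proof
      assume "a \<in> A"
      then have "a + p \<in> sumset (Suc h - c) A"
        using cpq sumset_SucI[of a A p "h - c"] by (simp add: Suc_diff_le)
      then show ?thesis
        using cpq z by (intro exI[of _ c] exI[of _ "a + p"] exI[of _ q]) auto
    next
      assume "a \<in> B"
      then have "a + q \<in> sumset (Suc c) B"
        using cpq sumset_SucI by blast
      then show ?thesis
        using cpq z by (intro exI[of _ "Suc c"] exI[of _ p] exI[of _ "a + q"]) auto
    qed
  qed auto
  then show ?thesis using that by blast
qed

text \<open>If one summand exceeds \<open>r\<close>, the other \<open>h - 1\<close> contribute at least \<open>(h - 1) * y\<close>, which is too much.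
For \<open>y = 0\<close> this says that only the elements up to \<open>z\<close> matter; a positive \<open>y\<close> allows an interval
reaching slightly below \<open>z\<close> to be added to a set without representing \<open>z\<close>.\<close>

lemma sumset_restrict:
  assumes "\<forall>a\<in>A. y \<le> a" "z \<in> sumset h A" "z \<le> (h - 1) * y + r"
  shows "z \<in> sumset h {a \<in> A. a \<le> r}"
  using assms(2,3)
proof (induction h arbitrary: z)
  case (Suc h)
  then obtain a s where a: "a \<in> A" and s: "s \<in> sumset h A" and z: "z = a + s"
    by (auto simp: sumset_Suc)
  have "h * y \<le> s" using sumset_ge[OF assms(1) s] .
  then have "a \<le> r" using Suc.prems z by simp
  moreover have "s \<in> sumset h {a \<in> A. a \<le> r}"
  proof (cases h)
    case 0
    then show ?thesis using s by simp
  next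
    case (Suc h')
    have "y \<le> a" using a assms(1) by blast
    then have "s \<le> (h - 1) * y + r"
      using Suc Suc.prems(2) z by simp
    then show ?thesis using Suc.IH[OF s] by simp
  qed
  ultimately show ?case using a z by (auto simp: sumset_Suc)
qed simp

lemma finite_sumset: "finite A \<Longrightarrow> finite (sumset h A)"
proof (induction h)
  case (Suc h)
  have "sumset (Suc h) A = (\<lambda>(a, s). a + s) ` (A \<times> sumset h A)"
    by (auto simp: sumset_Suc)
  with Suc show ?case by simp
qed simp

lemma card_sumset_le: "finite A \<Longrightarrow> card (sumset h A) \<le> card A ^ h"
proof (induction h)
  case (Suc h)
  have "sumset (Suc h) A = (\<lambda>(a, s). a + s) ` (A \<times> sumset h A)"
    by (auto simp: sumset_Suc)
  then have "card (sumset (Suc h) A) \<le> card A * card (sumset h A)"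
    using card_image_le[of "A \<times> sumset h A" "\<lambda>(a, s). a + s"] Suc.prems finite_sumset[OF Suc.prems]
    by (simp add: card_cartesian_product)
  also have "\<dots> \<le> card A * card A ^ h"
    using Suc by simp
  finally show ?case by simp
qed simp

definition progression :: "nat \<Rightarrow> nat \<Rightarrow> nat \<Rightarrow> nat set" where
  "progression t D K = (\<lambda>i. t + D * i) ` {..<K}"

text \<open>Modulo the difference only the number of summands remains visible.  Together with the two lemmas
that follow, this turns an equation between sums into a congruence in few unknowns.\<close>

lemma sumset_progression:
  "q \<in> sumset c (progression t D K) \<Longrightarrow> \<exists>m. q = c * t + D * m"
proof (induction c arbitrary: q)
  case (Suc c)
  then obtain i s where "s \<in> sumset c (progression t D K)" "q = t + D * i + s"
    by (auto simp: sumset_Suc progression_def)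
  with Suc.IH obtain m where "q = t + D * i + (c * t + D * m)" by blast
  then have "q = Suc c * t + D * (i + m)" by (simp add: algebra_simps)
  then show ?case by blast
qed simp

lemma sumset_singleton: "q \<in> sumset c {u} \<Longrightarrow> q = c * u"
  by (induction c arbitrary: q) (auto simp: sumset_Suc)

lemma sumset_reflection:
  assumes "\<forall>f\<in>F. f \<le> k" "k \<le> v" "q \<in> sumset c ((\<lambda>f. v - f) ` F)"
  shows "\<exists>\<phi>\<le>c * k. q + \<phi> = c * v"
  using assms(3)
proof (induction c arbitrary: q)
  case (Suc c)
  then obtain f s where f: "f \<in> F" and s: "s \<in> sumset c ((\<lambda>f. v - f) ` F)" and q: "q = v - f + s"
    by (auto simp: sumset_Suc)
  obtain \<phi> where "\<phi> \<le> c * k" "s + \<phi> = c * v"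
    using Suc.IH[OF s] by blast
  moreover have "f \<le> k" using f assms(1) by blast
  ultimately show ?case
    using q assms(2) by (intro exI[of _ "f + \<phi>"]) auto
qed simp

lemma card_progression_window:
  assumes "L \<le> D"
  shows "card (progression t D K \<inter> {x..<x + L}) \<le> 1"
proof -
  have "a = b" if "a \<in> progression t D K \<inter> {x..<x + L}" "b \<in> progression t D K \<inter> {x..<x + L}" for a b
  proof -
    from that obtain i j where ij: "a = t + D * i" "b = t + D * j"
      unfolding progression_def by blast
    have "\<not> i < j"
    proof
      assume "i < j"
      then have "D * (i + 1) \<le> D * j" by (intro mult_le_mono) auto
      then show False using that ij assms by auto
    qed
    moreover have "\<not> j < i"
    proof
      assume "j < i"
      then have "D * (j + 1) \<le> D * i" by (intro mult_le_mono) auto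
      then show False using that ij assms by auto
    qed
    ultimately show ?thesis using ij by simp
  qed
  then show ?thesis
    by (metis One_nat_def card_le_Suc0_iff_eq finite_Int finite_atLeastLessThan)
qed

section \<open>Avoiding residue classes\<close>

text \<open>A constraint \<open>(c, w)\<close> forbids the residue class solving \<open>c * x \<equiv> w\<close> modulo \<open>D\<close>.  As \<open>c\<close> is invertible,
it forbids at most one of any \<open>D\<close> consecutive integers, so fewer constraints than candidates leave
a candidate over.\<close>

lemma exists_avoiding_residues:
  fixes Bad :: "(int \<times> int) set" and D l a :: nat
  assumes fin: "finite Bad" and card: "card Bad < l" and l: "l \<le> D"
    and cop: "\<And>c w. (c, w) \<in> Bad \<Longrightarrow> coprime c (int D)"
  obtains x where "a < x" "x \<le> a + l" "\<And>c w. (c, w) \<in> Bad \<Longrightarrow> \<not> int D dvd c * int x - w"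
proof (rule ccontr)
  assume "\<not> thesis"
  with that have "\<forall>x\<in>{a<..a+l}. \<exists>cw\<in>Bad. int D dvd fst cw * int x - snd cw"
    by fastforce
  then obtain g where g: "\<And>x. x \<in> {a<..a+l} \<Longrightarrow> g x \<in> Bad \<and> int D dvd fst (g x) * int x - snd (g x)"
    by metis
  have "inj_on g {a<..a+l}"
  proof (rule inj_onI)
    fix x y assume x: "x \<in> {a<..a+l}" and y: "y \<in> {a<..a+l}" and eq: "g x = g y"
    have "int D dvd (fst (g x) * int x - snd (g x)) - (fst (g y) * int y - snd (g y))"
      using g[OF x] g[OF y] by (meson dvd_diff)
    then have "int D dvd fst (g x) * (int x - int y)"
      using eq by (simp add: algebra_simps)
    moreover have "coprime (int D) (fst (g x))"
      using cop[of "fst (g x)" "snd (g x)"] g[OF x] by (simp add: coprime_commute)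
    ultimately have dvd: "int D dvd int x - int y"
      by (simp add: coprime_dvd_mult_right_iff)
    have "\<bar>int x - int y\<bar> < int D"
      using x y l by auto
    then have "int x - int y = 0"
      using dvd dvd_imp_le_int[of "int x - int y" "int D"] by linarith
    then show "x = y" by simp
  qed
  moreover have "g ` {a<..a+l} \<subseteq> Bad"
    using g by blast
  ultimately have "card {a<..a+l} \<le> card Bad"
    using fin by (rule card_inj_on_le)
  then show False using card by simp
qed

text \<open>All moduli below are products of numbers congruent to \<open>1\<close> modulo a factorial, so that every small
coefficient is invertible.\<close>

lemma coprime_of_mod_fact:
  fixes d :: int and m :: nat
  assumes "d \<noteq> 0" "\<bar>d\<bar> \<le> int M" "L mod fact M = 1"
  shows "coprime d (int L)"
proof (rule coprimeI)
  fix c :: int assume c: "c dvd d" "c dvd int L"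
  have "nat \<bar>d\<bar> dvd fact M"
    using assms by (intro dvd_fact) auto
  then have "d dvd int (fact M)"
    by (metis abs_dvd_iff dvd_abs_iff int_dvd_int_iff int_nat_eq abs_ge_zero)
  then have "c dvd int (fact M)"
    using c dvd_trans by blast
  moreover have "int L = int (fact M) * int (L div fact M) + 1"
    using assms(3) by (metis mult_div_mod_eq of_nat_1 of_nat_add of_nat_mult)
  ultimately show "is_unit c"
    using c(2) by (metis dvd_add_right_iff dvd_mult2)
qed

section \<open>Number systems with generic offsets\<close>

text \<open>The starting point \<open>\<tau>\<close> of a progression is chosen such that using the progression \<open>c + 1 \<ge> 2\<close> times,
together with \<open>j - c\<close> elements of \<open>P\<close>, never hits the residue class of \<open>\<alpha> + \<tau>\<close>.  This is possible
because at most \<open>j - 1\<close> elements of \<open>P\<close> enter, so that few classes are forbidden.\<close>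

lemma exists_generic_offset:
  fixes P :: "nat set" and D N j \<alpha> :: nat
  assumes fin: "finite P" and ne: "P \<noteq> {}" and j: "1 \<le> j"
    and cop: "\<And>c. 1 \<le> c \<Longrightarrow> c \<le> j \<Longrightarrow> coprime (int c) (int D)"
    and card: "j * card P ^ (j - 1) < D div 2"
  obtains \<tau> where "N < \<tau>" "\<tau> \<le> N + D div 2"
    "\<And>c s. 1 \<le> c \<Longrightarrow> c \<le> j \<Longrightarrow> s \<in> sumset (j - c) P \<Longrightarrow> \<not> int D dvd int (c * \<tau> + s) - int \<alpha>"
proof -
  define E where "E = (SIGMA c:{1..j}. sumset (j - c) P)"
  define Bad where "Bad = (\<lambda>(c, s). (int c, int \<alpha> - int s)) ` E"
  have finE: "finite E"
    using fin finite_sumset by (auto simp: E_def)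
  have "card E = (\<Sum>c\<in>{1..j}. card (sumset (j - c) P))"
    using fin finite_sumset by (simp add: E_def)
  also have "\<dots> \<le> (\<Sum>c\<in>{1..j}. card P ^ (j - 1))"
  proof (rule sum_mono)
    fix c assume "c \<in> {1..j}"
    then have "card P ^ (j - c) \<le> card P ^ (j - 1)"
      using fin ne by (intro power_increasing) (auto simp: Suc_le_eq card_gt_0_iff)
    then show "card (sumset (j - c) P) \<le> card P ^ (j - 1)"
      using card_sumset_le[OF fin, of "j - c"] by simp
  qed
  finally have "card Bad < D div 2"
    using card card_image_le[OF finE, of "\<lambda>(c, s). (int c, int \<alpha> - int s)"] by (simp add: Bad_def)
  moreover have "coprime c (int D)" if "(c, w) \<in> Bad" for c w
    using that cop by (auto simp: Bad_def E_def)
  moreover have "finite Bad" using finE by (simp add: Bad_def)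
  ultimately obtain \<tau> where \<tau>: "N < \<tau>" "\<tau> \<le> N + D div 2"
      "\<And>c w. (c, w) \<in> Bad \<Longrightarrow> \<not> int D dvd c * int \<tau> - w"
    using exists_avoiding_residues[of Bad "D div 2" D N] by auto
  have "\<not> int D dvd int (c * \<tau> + s) - int \<alpha>"
    if "1 \<le> c" "c \<le> j" "s \<in> sumset (j - c) P" for c s
  proof -
    have "(int c, int \<alpha> - int s) \<in> Bad"
      using that by (force simp: Bad_def E_def)
    from \<tau>(3)[OF this] show ?thesis by (simp add: algebra_simps)
  qed
  with \<tau> that show ?thesis by blast
qed

text \<open>This is division with remainder: the progression supplies the quotient by \<open>D\<close>, the block the remainder.\<close>

lemma progression_extends_block:
  fixes P :: "nat set"
  assumes D: "0 < D"
    and block: "{\<alpha>..<\<alpha> + D} \<subseteq> sumset j P"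
  shows "{\<alpha> + \<tau>..<\<alpha> + \<tau> + D * K} \<subseteq> sumset (Suc j) (P \<union> progression \<tau> D K)"
proof
  fix z assume z: "z \<in> {\<alpha> + \<tau>..<\<alpha> + \<tau> + D * K}"
  define q r where "q = (z - \<alpha> - \<tau>) div D" and "r = (z - \<alpha> - \<tau>) mod D"
  have zqr: "z = (\<tau> + D * q) + (\<alpha> + r)"
    using z mult_div_mod_eq[of D "z - \<alpha> - \<tau>"] unfolding q_def r_def atLeastLessThan_iff by linarith
  have "z - \<alpha> - \<tau> < D * K" using z by auto
  then have "q < K" using D unfolding q_def by (simp add: less_mult_imp_div_less mult.commute)
  then have "\<tau> + D * q \<in> P \<union> progression \<tau> D K"
    by (auto simp: progression_def)
  moreover have "\<alpha> + r \<in> sumset j P"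
    using block D by (auto simp: r_def)
  ultimately show "z \<in> sumset (Suc j) (P \<union> progression \<tau> D K)"
    unfolding zqr using sumset_mono[of P "P \<union> progression \<tau> D K" j] by (intro sumset_SucI) auto
qed

text \<open>The integer after the last block stays unrepresented, and so do its translates by multiples of the
new modulus \<open>D * K\<close>; it is these translates that make the statement inductive.  The reason depends
on how often the progression is used.  Not at all: the sum is too small.  Once: removing that
summand leaves a translate of \<open>\<alpha> + D\<close> by a nonnegative multiple of \<open>D\<close>, because a progression term
has a quotient below \<open>K\<close>.  More often: the residue class is wrong by the choice of \<open>\<tau>\<close>.\<close>

lemma progression_keeps_exact_end:
  fixes P :: "nat set"
  assumes D: "0 < D" and le: "\<forall>p\<in>P. p \<le> m" and m: "(j + 1) * m < D * K"
    and exact: "\<And>i. \<alpha> + D + i * D \<notin> sumset j P"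
    and generic: "\<And>c s. 1 \<le> c \<Longrightarrow> c \<le> j \<Longrightarrow> s \<in> sumset (j - c) P \<Longrightarrow>
                    \<not> int D dvd int (c * \<tau> + s) - int \<alpha>"
  shows "\<alpha> + \<tau> + D * K + i * (D * K) \<notin> sumset (Suc j) (P \<union> progression \<tau> D K)"
proof
  assume "\<alpha> + \<tau> + D * K + i * (D * K) \<in> sumset (Suc j) (P \<union> progression \<tau> D K)"
  then obtain c p q where c: "c \<le> Suc j" and p: "p \<in> sumset (Suc j - c) P"
      and q: "q \<in> sumset c (progression \<tau> D K)" and z: "\<alpha> + \<tau> + D * K + i * (D * K) = p + q"
    by (rule sumset_Un)
  consider "c = 0" | "c = 1" | c' where "c = Suc c'" "1 \<le> c'" "c' \<le> j"
    using c by (cases c) (auto simp: Suc_le_eq neq0_conv)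
  then show False
  proof cases
    case 1
    then have "p \<le> Suc j * m" "q = 0"
      using sumset_le[OF le p] q by auto
    then show False using z m by simp
  next
    case 2
    then obtain l where l: "l < K" "q = \<tau> + D * l" and p': "p \<in> sumset j P"
      using p q by (auto simp: progression_def)
    define i' where "i' = K * (1 + i) - l - 1"
    have "l + 1 \<le> K * (1 + i)"
      using l(1) by (simp add: add_mult_distrib2)
    then have "K * (1 + i) = l + 1 + i'" by (simp add: i'_def)
    then have "D * (K * (1 + i)) = D * (l + 1 + i')" by simp
    then have "p = \<alpha> + D + i' * D"
      using z l(2) by (simp add: algebra_simps)
    then show False using exact p' by blast
  next
    case 3
    obtain l where l: "q = c * \<tau> + D * l"
      using sumset_progression[OF q] by blast
    have "int p + int q = int \<alpha> + int \<tau> + int D * (int K + int i * int K)"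
      using arg_cong[OF z, of int] by (simp add: algebra_simps)
    then have "int (c' * \<tau> + p) - int \<alpha> = int D * (int K + int i * int K - int l)"
      using l 3(1) by (simp add: algebra_simps)
    then have "int D dvd int (c' * \<tau> + p) - int \<alpha>" by simp
    moreover have "p \<in> sumset (j - c') P" using p 3(1) by simp
    ultimately show False using generic 3 by blast
  qed
qed

text \<open>The set \<open>P\<close> is the result of \<open>j - 1\<close> extensions of \<open>Y\<close>, by progressions with \<open>K\<close> terms and differences
\<open>L\<close>, \<open>L * K\<close>, \<open>L * K\<^sup>2\<close> and so on.  Its \<open>j\<close>-fold sums contain a block of \<open>L * K ^ (j - 1)\<close> integers
starting at \<open>\<alpha>\<close>, whose end is exact in the sense of \<open>progression_keeps_exact_end\<close>.  The next-to-last
clause says that \<open>P - Y\<close> is sparse.  The last one says that the \<open>h\<close>-fold sums have no gap up to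
a little beyond \<open>\<alpha>\<close>, far enough for the block of the next rung to continue them.\<close>

definition ladder :: "nat \<Rightarrow> nat \<Rightarrow> nat set \<Rightarrow> nat \<Rightarrow> nat \<Rightarrow> nat \<Rightarrow> nat set \<Rightarrow> nat \<Rightarrow> bool" where
  "ladder h N Y L K j P \<alpha> \<longleftrightarrow>
     finite P \<and> Y \<subseteq> P \<and> (\<forall>p\<in>P - Y. N < p) \<and> (\<forall>p\<in>P. p \<le> N + L * K ^ (j - 1)) \<and>
     card P \<le> N + 1 + (j - 1) * K \<and>
     {\<alpha>..<\<alpha> + L * K ^ (j - 1)} \<subseteq> sumset j P \<and>
     (\<forall>i. \<alpha> + L * K ^ (j - 1) + i * (L * K ^ (j - 1)) \<notin> sumset j P) \<and>
     N + 1 \<le> \<alpha> + L * K ^ (j - 1) \<and> 0 < \<alpha> \<and>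
     (\<forall>x. card ((P - Y) \<inter> {x..<x + L}) \<le> j - 1) \<and>
     (\<forall>z. N + 2 * h\<^sup>2 \<le> z \<and> z \<le> \<alpha> + N + L * K ^ (j - 1) div 2 + 2 * h\<^sup>2 \<longrightarrow> z \<in> sumset h P)"

lemma card_power_bound:
  assumes "1 \<le> j" "j \<le> h" "1 \<le> K" "N + 1 \<le> K" "card P \<le> N + 1 + (j - 1) * K"
  shows "card P \<le> h * K" "card P ^ i \<le> h ^ i * K ^ i"
proof -
  have "card P \<le> j * K"
    using assms by (cases j) auto
  also have "\<dots> \<le> h * K" using assms by simp
  finally show *: "card P \<le> h * K" .
  show "card P ^ i \<le> h ^ i * K ^ i"
    using power_mono[OF *, of i] by (simp add: power_mult_distrib)
qed

text \<open>The first rung is the block of \<open>L\<close> consecutive integers at the top of \<open>Y\<close>.  In the induction step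
the forbidden classes number at most \<open>j * card P ^ (j - 1)\<close>, which is of order \<open>K ^ (j - 1)\<close>.  The modulus
\<open>L * K ^ (j - 1)\<close> beats this for a constant \<open>L\<close> depending only on \<open>h\<close>, whatever \<open>K\<close> is.\<close>

lemma ladder_exists:
  assumes Y: "Y \<subseteq> {..N}" "{N - L<..N} \<subseteq> Y" and L: "L \<le> N" "4 * h ^ h + 4 * h\<^sup>2 + 8 \<le> L"
    and K: "(h + 1) * (N + 2 * h\<^sup>2 + 2) < K"
    and res: "L mod fact (h\<^sup>2) = 1" "K mod fact (h\<^sup>2) = 1"
    and cover: "\<And>z. N + 2 * h\<^sup>2 \<le> z \<Longrightarrow> z \<le> 2 * N \<Longrightarrow> z \<in> sumset h Y"
    and y: "y \<in> Y" "y \<le> 2 * h"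
    and j: "1 \<le> j" "j < h"
  shows "\<exists>P \<alpha>. ladder h N Y L K j P \<alpha>"
  using j
proof (induction j rule: nat_induct_at_least)
  case base
  have "ladder h N Y L K 1 Y (N - L + 1)"
    unfolding ladder_def
  proof (intro conjI allI impI)
    show "finite Y" using Y(1) finite_subset by blast
    show "card Y \<le> N + 1 + (1 - 1) * K"
      using card_mono[OF _ Y(1)] by simp
    show "{N - L + 1..<N - L + 1 + L * K ^ (1 - 1)} \<subseteq> sumset 1 Y"
      using Y(2) L(1) by (auto simp: subset_iff)
    fix i show "N - L + 1 + L * K ^ (1 - 1) + i * (L * K ^ (1 - 1)) \<notin> sumset 1 Y"
      using Y(1) L(1) by (auto simp: subset_iff)
  next
    fix z assume z: "N + 2 * h\<^sup>2 \<le> z \<and> z \<le> N - L + 1 + N + L * K ^ (1 - 1) div 2 + 2 * h\<^sup>2"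
    then have "z \<le> N - L + 1 + N + L div 2 + 2 * h\<^sup>2" by simp
    then have "z \<le> 2 * N" using L by linarith
    then show "z \<in> sumset h Y" using cover z by blast
  next
    show "\<forall>p\<in>Y. p \<le> N + L * K ^ (1 - 1)"
      using Y(1) by fastforce
  qed (use L in auto)
  then show ?case by blast
next
  case (Suc j)
  define D where "D = L * K ^ (j - 1)"
  have DK: "L * K ^ (Suc j - 1) = D * K"
    using Suc.hyps by (cases j) (auto simp: D_def)
  from Suc obtain P \<alpha> where "ladder h N Y L K j P \<alpha>" by auto
  then have P: "finite P" "Y \<subseteq> P" "\<forall>p\<in>P - Y. N < p" "\<forall>p\<in>P. p \<le> N + D"
      "card P \<le> N + 1 + (j - 1) * K" "{\<alpha>..<\<alpha> + D} \<subseteq> sumset j P"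
      "\<And>i. \<alpha> + D + i * D \<notin> sumset j P" "N + 1 \<le> \<alpha> + D"
      "\<And>x. card ((P - Y) \<inter> {x..<x + L}) \<le> j - 1"
      "\<And>z. N + 2 * h\<^sup>2 \<le> z \<Longrightarrow> z \<le> \<alpha> + N + D div 2 + 2 * h\<^sup>2 \<Longrightarrow> z \<in> sumset h P"
    unfolding ladder_def D_def by blast+
  have h2: "2 \<le> h" using Suc by linarith
  have K1: "N + 1 \<le> K" "1 \<le> K"
    using K by auto
  have LD: "L \<le> D" using K1(2) unfolding D_def by simp
  have D0: "0 < D" using LD L by linarith
  have card_P: "card P \<le> h * K" "card P ^ i \<le> h ^ i * K ^ i" for i
    using card_power_bound(1)[of j h K N P] card_power_bound(2)[of j h K N P i] Suc P(5) K1 by auto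
  have "j * card P ^ (j - 1) \<le> h * (h ^ (j - 1) * K ^ (j - 1))"
    using card_P(2)[of "j - 1"] Suc by (intro mult_le_mono) auto
  also have "\<dots> = h ^ j * K ^ (j - 1)"
    using Suc.hyps by (cases j) auto
  also have "\<dots> \<le> h ^ h * K ^ (j - 1)"
    using Suc h2 by (intro mult_le_mono1 power_increasing) auto
  finally have 1: "j * card P ^ (j - 1) \<le> h ^ h * K ^ (j - 1)" .
  have "(4 * h ^ h + 4) * K ^ (j - 1) \<le> D"
    unfolding D_def using L by (intro mult_le_mono) auto
  moreover have "1 \<le> K ^ (j - 1)" using K1(2) by simp
  ultimately have generic_card: "j * card P ^ (j - 1) < D div 2"
    using 1 by (simp add: add_mult_distrib)
  have cop: "coprime (int c) (int D)" if "1 \<le> c" "c \<le> j" for c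
  proof -
    have "c \<le> h\<^sup>2" using that Suc.prems by (simp add: power2_eq_square) (meson le_square le_trans less_imp_le Suc_leD)
    then have "int c \<noteq> 0" "\<bar>int c\<bar> \<le> int (h\<^sup>2)" using that by auto
    then have "coprime (int c) (int L)" "coprime (int c) (int K)"
      using res by (blast intro: coprime_of_mod_fact)+
    then show ?thesis by (simp add: D_def)
  qed
  have "P \<noteq> {}" using P(2) y(1) by blast
  from exists_generic_offset[OF P(1) this Suc.hyps cop generic_card, of N \<alpha>]
  obtain \<tau> where \<tau>: "N < \<tau>" "\<tau> \<le> N + D div 2"
    "\<And>c s. 1 \<le> c \<Longrightarrow> c \<le> j \<Longrightarrow> s \<in> sumset (j - c) P \<Longrightarrow> \<not> int D dvd int (c * \<tau> + s) - int \<alpha>"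
    by blast
  define T where "T = progression \<tau> D K"
  have block: "{\<alpha> + \<tau>..<\<alpha> + \<tau> + D * K} \<subseteq> sumset (Suc j) (P \<union> T)"
    unfolding T_def by (rule progression_extends_block[OF D0 P(6)])
  have "(j + 1) * (N + D) \<le> (h + 1) * ((N + 1) * D)"
    using Suc.prems D0 by (intro mult_le_mono) auto
  also have "\<dots> < D * K"
  proof -
    have "D * ((h + 1) * (N + 1)) < D * K"
      using K D0 by (intro mult_strict_left_mono) (auto simp: algebra_simps)
    then show ?thesis by (simp only: mult_ac)
  qed
  finally have exact: "\<alpha> + \<tau> + D * K + i * (D * K) \<notin> sumset (Suc j) (P \<union> T)" for i
    unfolding T_def
    by (intro progression_keeps_exact_end[where m = "N + D"] D0 P(4,7) \<tau>(3)) auto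
  have T_le: "p \<le> N + D * K" if "p \<in> T" for p
  proof -
    from that obtain i where i: "i < K" "p = \<tau> + D * i"
      unfolding T_def progression_def by blast
    have "D * (i + 1) \<le> D * K" using i(1) by (intro mult_le_mono) auto
    then show ?thesis using i(2) \<tau>(2) by simp
  qed
  have D_DK: "D \<le> D * K" using K1(2) by simp
  have T_gt: "N < p" if "p \<in> T" for p
    using that \<tau>(1) by (auto simp: T_def progression_def)
  have card_T: "card T \<le> K"
    unfolding T_def progression_def using card_image_le[of "{..<K}"] by simp
  have window: "card ((P \<union> T - Y) \<inter> {x..<x + L}) \<le> j" for x
  proof -
    have "(P \<union> T - Y) \<inter> {x..<x + L} \<subseteq> ((P - Y) \<inter> {x..<x + L}) \<union> (T \<inter> {x..<x + L})" by blast
    then have "card ((P \<union> T - Y) \<inter> {x..<x + L}) \<le> card (((P - Y) \<inter> {x..<x + L}) \<union> (T \<inter> {x..<x + L}))"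
      by (intro card_mono) auto
    also have "\<dots> \<le> card ((P - Y) \<inter> {x..<x + L}) + card (T \<inter> {x..<x + L})"
      by (rule card_Un_le)
    also have "\<dots> \<le> (j - 1) + 1"
      using P(9) card_progression_window[OF LD, of \<tau> K x] unfolding T_def by (intro add_mono) auto
    finally show ?thesis using Suc.hyps by simp
  qed
  have "ladder h N Y L K (Suc j) (P \<union> T) (\<alpha> + \<tau>)"
    unfolding ladder_def DK
  proof (intro conjI allI impI)
    show "finite (P \<union> T)" using P(1) by (simp add: T_def progression_def)
    show "card (P \<union> T) \<le> N + 1 + (Suc j - 1) * K"
      using card_Un_le[of P T] card_T P(5) Suc.hyps by (cases j) auto
    show "\<forall>p\<in>P \<union> T. p \<le> N + D * K"
      using T_le P(4) add_left_mono[OF D_DK, of N] by (meson UnE le_trans)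
    show "N + 1 \<le> \<alpha> + \<tau> + D * K" "0 < \<alpha> + \<tau>" using \<tau>(1) by simp_all
    show "card ((P \<union> T - Y) \<inter> {x..<x + L}) \<le> Suc j - 1" for x
      using window by simp
  next
    fix z assume z: "N + 2 * h\<^sup>2 \<le> z \<and> z \<le> \<alpha> + \<tau> + N + D * K div 2 + 2 * h\<^sup>2"
    show "z \<in> sumset h (P \<union> T)"
    proof (cases "z \<le> \<alpha> + N + D div 2 + 2 * h\<^sup>2")
      case True
      then show ?thesis using P(10)[of z] z sumset_mono[of P "P \<union> T" h] by auto
    next
      case False
      \<comment> \<open>padding with copies of the small element \<open>y\<close> makes sums of \<open>h\<close> elements out of sums of \<open>j + 1\<close>\<close>
      define z' where "z' = z - (h - Suc j) * y"
      have "(h - Suc j) * y \<le> h * (2 * h)" using y by (intro mult_le_mono) auto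
      also have "\<dots> = 2 * h\<^sup>2" by (simp add: power2_eq_square)
      finally have hy: "(h - Suc j) * y \<le> 2 * h\<^sup>2" .
      have "1 * (2 * (N + 2 * h\<^sup>2 + 1)) \<le> D * K"
      proof (intro mult_le_mono)
        have "2 * (N + 2 * h\<^sup>2 + 2) \<le> (h + 1) * (N + 2 * h\<^sup>2 + 2)"
          using h2 by (intro mult_le_mono) auto
        then have "2 * (N + 2 * h\<^sup>2 + 2) < K" using K by (rule le_less_trans)
        then show "2 * (N + 2 * h\<^sup>2 + 1) \<le> K" by simp
      qed (use D0 in auto)
      moreover have "a + c div 2 + 2 * b < c" if "1 * (2 * (a + 2 * b + 1)) \<le> c" for a b c :: nat
        using that by presburger
      ultimately have "N + D * K div 2 + 2 * h\<^sup>2 < D * K" by blast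
      then have "z' \<in> {\<alpha> + \<tau>..<\<alpha> + \<tau> + D * K}"
        using False z hy \<tau>(2) unfolding z'_def atLeastLessThan_iff by linarith
      then have "z' \<in> sumset (Suc j) (P \<union> T)" using block by blast
      moreover have "(h - Suc j) * y \<in> sumset (h - Suc j) (P \<union> T)"
        using y P(2) by (intro sumset_mult) auto
      ultimately have "z' + (h - Suc j) * y \<in> sumset (Suc j + (h - Suc j)) (P \<union> T)"
        by (rule sumset_add)
      moreover have "z' + (h - Suc j) * y = z" using False hy by (simp add: z'_def)
      ultimately show ?thesis using Suc.prems by simp
    qed
  qed (use P(2,3) T_gt block exact in auto)
  then show ?case by blast
qed

section \<open>Markers for the critical elements\<close>

text \<open>The bound on the number of summands is decisive: with \<open>2 \<le> i + j + c\<close> at most \<open>h - 2\<close> elements of \<open>P\<close>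
enter, and their sums fill only a small proportion of the residues modulo \<open>D\<close>.  In the application
\<open>u\<close> occurs \<open>i\<close> times, elements \<open>n - (h - 2) * u - f\<close> occur \<open>j\<close> times with total \<open>f\<close>-part \<open>\<phi>\<close>, and the
progression starting at \<open>\<tau>\<close> occurs \<open>c\<close> times.  The coefficient of \<open>u\<close> is then \<open>i - j * (h - 2)\<close>.\<close>

lemma exists_generic_summand:
  fixes P :: "nat set" and D h k n \<tau> W :: nat
  assumes fin: "finite P" and ne: "P \<noteq> {}" and h: "2 \<le> h"
    and cop: "\<And>d::int. d \<noteq> 0 \<Longrightarrow> \<bar>d\<bar> \<le> int (h\<^sup>2) \<Longrightarrow> coprime d (int D)"
    and card: "(h + 1) ^ 3 * (h * k + 1) * card P ^ (h - 2) < D"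
  obtains u where "W < u" "u \<le> W + D"
    "\<And>i j c \<phi> s. 2 \<le> i + j + c \<Longrightarrow> i + j + c \<le> h \<Longrightarrow> i \<noteq> j * (h - 2) \<Longrightarrow> \<phi> \<le> h * k \<Longrightarrow>
       s \<in> sumset (h - (i + j + c)) P \<Longrightarrow>
       \<not> int D dvd (int i - int (j * (h - 2))) * int u + (int j - 1) * int n + int (c * \<tau> + s) - int \<phi>"
proof -
  define J where "J = {(i, j, c, \<phi>). 2 \<le> i + j + c \<and> i + j + c \<le> h \<and> i \<noteq> j * (h - 2) \<and> \<phi> \<le> h * k}"
  define E where "E = (SIGMA (i, j, c, \<phi>):J. sumset (h - (i + j + c)) P)"
  define g where "g = (\<lambda>((i, j, c, \<phi>), s). (int i - int (j * (h - 2)),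
                     int \<phi> - (int j - 1) * int n - int (c * \<tau> + s)))"
  have sub: "J \<subseteq> {..h} \<times> {..h} \<times> {..h} \<times> {..h * k}"
    by (auto simp: J_def)
  have finJ: "finite J"
    by (rule finite_subset[OF sub]) auto
  have cardJ: "card J \<le> (h + 1) ^ 3 * (h * k + 1)"
  proof -
    have "card J \<le> card ({..h} \<times> {..h} \<times> {..h} \<times> {..h * k})"
      by (rule card_mono[OF _ sub]) simp
    also have "\<dots> = (h + 1) * ((h + 1) * ((h + 1) * (h * k + 1)))"
      by (simp only: card_cartesian_product card_atMost Suc_eq_plus1)
    finally show ?thesis by (simp only: power3_eq_cube mult.assoc)
  qed
  have finE: "finite E"
    unfolding E_def using finJ fin finite_sumset by (intro finite_SigmaI) auto
  have "card E = (\<Sum>x\<in>J. card (case x of (i, j, c, \<phi>) \<Rightarrow> sumset (h - (i + j + c)) P))"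
    unfolding E_def using finJ fin finite_sumset by (subst card_SigmaI) auto
  also have "\<dots> \<le> (\<Sum>x\<in>J. card P ^ (h - 2))"
  proof (rule sum_mono)
    fix x assume "x \<in> J"
    then obtain i j c \<phi> where x: "x = (i, j, c, \<phi>)" "2 \<le> i + j + c"
      by (auto simp: J_def)
    have "card P ^ (h - (i + j + c)) \<le> card P ^ (h - 2)"
      using fin ne x by (intro power_increasing) (auto simp: Suc_le_eq card_gt_0_iff)
    then show "card (case x of (i, j, c, \<phi>) \<Rightarrow> sumset (h - (i + j + c)) P) \<le> card P ^ (h - 2)"
      using card_sumset_le[OF fin, of "h - (i + j + c)"] x by simp
  qed
  also have "\<dots> \<le> (h + 1) ^ 3 * (h * k + 1) * card P ^ (h - 2)"
    using cardJ by simp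
  finally have "card (g ` E) < D"
    using card card_image_le[OF finE, of g] by simp
  moreover have "coprime c (int D)" if "(c, w) \<in> g ` E" for c w
  proof -
    from that obtain i j c' \<phi> where *: "(i, j, c', \<phi>) \<in> J" "c = int i - int (j * (h - 2))"
      by (auto simp: E_def g_def)
    then have ij: "i \<le> h" "j \<le> h" "i \<noteq> j * (h - 2)"
      by (auto simp: J_def)
    have "j * (h - 2) \<le> h * h" using ij by (intro mult_le_mono) auto
    moreover have "i \<le> h * h" using ij(1) by (meson le_square le_trans)
    ultimately have "\<bar>c\<bar> \<le> int (h * h)" unfolding *(2) by linarith
    moreover have "c \<noteq> 0" using ij(3) *(2) by linarith
    ultimately show ?thesis using cop by (simp add: power2_eq_square)
  qed
  moreover have "finite (g ` E)" using finE by simp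
  ultimately obtain u where u: "W < u" "u \<le> W + D"
      "\<And>c w. (c, w) \<in> g ` E \<Longrightarrow> \<not> int D dvd c * int u - w"
    using exists_avoiding_residues[of "g ` E" D D W] by blast
  have "\<not> int D dvd (int i - int (j * (h - 2))) * int u + (int j - 1) * int n + int (c * \<tau> + s) - int \<phi>"
    if "2 \<le> i + j + c" "i + j + c \<le> h" "i \<noteq> j * (h - 2)" "\<phi> \<le> h * k" "s \<in> sumset (h - (i + j + c)) P"
    for i j c \<phi> s
  proof -
    have "((i, j, c, \<phi>), s) \<in> E"
      using that by (simp add: E_def J_def)
    then have "g ((i, j, c, \<phi>), s) \<in> g ` E" by (rule imageI)
    then have "(int i - int (j * (h - 2)), int \<phi> - (int j - 1) * int n - int (c * \<tau> + s)) \<in> g ` E"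
      by (simp only: g_def prod.case)
    from u(3)[OF this] show ?thesis by (simp add: algebra_simps)
  qed
  with u that show ?thesis by blast
qed

text \<open>The markers \<open>u\<close> and \<open>v - f\<close> represent \<open>n\<close> as \<open>(h - 2) * u + (v - f) + f\<close>, and this is the only way in
which they help.  Suppose \<open>u\<close> occurs \<open>i\<close> times in a sum and the \<open>v - f\<close> occur \<open>j\<close> times.  The
coefficient \<open>i - j * (h - 2)\<close> of \<open>u\<close> vanishes for \<open>i = j = 0\<close>, which is no use of markers, and
for \<open>j = 1\<close>, \<open>i = h - 2\<close>, which forces the last summand to be \<open>f\<close> itself.  A few extreme sums,
among them those of a single marker and elements of \<open>P\<close>, are excluded by their size; in all other
cases the coefficient does not vanish and the choice of \<open>u\<close> excludes the sum modulo \<open>D\<close>.\<close>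

lemma hole_survives_markers:
  fixes P F :: "nat set"
  assumes h: "2 \<le> h" and n: "n = (h - 2) * u + v"
    and hole: "n \<notin> sumset h (P \<union> progression \<tau> D K)"
    and F: "\<forall>f\<in>F. f \<le> k" and le: "\<forall>p\<in>P. p \<le> m"
    and size: "h * m < u" "u + h * m < n" "k < u" "2 * k < v"
    and generic: "\<And>i j c \<phi> s. 2 \<le> i + j + c \<Longrightarrow> i + j + c \<le> h \<Longrightarrow> i \<noteq> j * (h - 2) \<Longrightarrow> \<phi> \<le> h * k \<Longrightarrow>
       s \<in> sumset (h - (i + j + c)) P \<Longrightarrow>
       \<not> int D dvd (int i - int (j * (h - 2))) * int u + (int j - 1) * int n + int (c * \<tau> + s) - int \<phi>"
  shows "n \<notin> sumset h ((P \<union> progression \<tau> D K \<union> ({u} \<union> (\<lambda>f. v - f) ` F)) - F)"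
proof
  let ?V = "P \<union> progression \<tau> D K" and ?M = "(\<lambda>f. v - f) ` F"
  assume "n \<in> sumset h ((?V \<union> ({u} \<union> ?M)) - F)"
  then have "n \<in> sumset h ((?V - F) \<union> ({u} \<union> ?M))"
    using sumset_mono[of "(?V \<union> ({u} \<union> ?M)) - F" "(?V - F) \<union> ({u} \<union> ?M)" h] by blast
  then obtain b p q where b: "b \<le> h" and p: "p \<in> sumset (h - b) (?V - F)"
      and q: "q \<in> sumset b ({u} \<union> ?M)" and npq: "n = p + q"
    by (rule sumset_Un)
  from q obtain j q1 q2 where j: "j \<le> b" and q1: "q1 \<in> sumset (b - j) {u}"
      and q2: "q2 \<in> sumset j ?M" and q12: "q = q1 + q2"
    by (rule sumset_Un)
  define i where "i = b - j"
  have b_eq: "b = i + j" using j by (simp add: i_def)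
  have q1_eq: "q1 = i * u" using sumset_singleton[OF q1] by (simp add: i_def)
  have kv: "k \<le> v" using size(4) by simp
  obtain \<phi> where \<phi>: "\<phi> \<le> j * k" "q2 + \<phi> = j * v"
    using sumset_reflection[OF F kv q2] by blast
  have pV: "p \<in> sumset (h - b) ?V" using p sumset_mono[of "?V - F" ?V] by blast
  \<comment> \<open>for \<open>h = 2\<close> the coefficient also vanishes at \<open>j = 2\<close>; that case is covered by \<open>two\<close>\<close>
  consider (none) "i = 0" "j = 0" | (one) "j = 1" "i = h - 2" | (three) "j = 1" "i = h - 1"
    | (two) "j = 2" "i = h - 2" | (gen) "i \<noteq> j * (h - 2)" "j = 0 \<or> i < h - 2" "1 \<le> i + j"
  proof (cases "j = 0")
    case True
    then show ?thesis using that by (cases "i = 0") auto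
  next
    case False
    show ?thesis
    proof (cases "h - 2 \<le> i")
      case True
      then have "(j = 1 \<and> (i = h - 2 \<or> i = h - 1)) \<or> (j = 2 \<and> i = h - 2)"
        using False b b_eq h by linarith
      then show ?thesis using that by blast
    next
      case gt: False
      have "1 * (h - 2) \<le> j * (h - 2)" using False by (intro mult_le_mono) auto
      then have "i \<noteq> j * (h - 2)" using gt by linarith
      then show ?thesis using that gt False by auto
    qed
  qed
  then show False
  proof cases
    case none
    then show False using hole pV npq q12 q1_eq \<phi> b_eq by simp
  next
    case one
    then have "h - b = 1" using b_eq h by linarith
    then have "p \<in> ?V - F" using p by simp
    moreover from q2 one obtain f where f: "f \<in> F" "q2 = v - f" by auto
    then have "p = f"
      using npq q12 q1_eq one n F kv by fastforce
    ultimately show False using f by blast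
  next
    case three
    then have "h - b = 0" using b_eq h by linarith
    then have p0: "p = 0" using p by simp
    have "(h - 1) * u = (h - 2) * u + u"
      using h by (cases h) (auto simp: algebra_simps Suc_diff_le dest: le_Suc_ex)
    then have "n + \<phi> = (h - 2) * u + u + v"
      using npq q12 q1_eq p0 \<phi> three by simp
    then show False using n \<phi>(1) three size(3) by simp
  next
    case two
    then have "h - b = 0" using b_eq h by linarith
    then have p0: "p = 0" using p by simp
    then have "n + \<phi> = (h - 2) * u + 2 * v"
      using npq q12 q1_eq p0 \<phi> two by simp
    then show False using n \<phi>(1) two size(4) by simp
  next
    case gen
    from pV obtain c s t where c: "c \<le> h - b" and s: "s \<in> sumset (h - b - c) P"
        and t: "t \<in> sumset c (progression \<tau> D K)" and pst: "p = s + t"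
      by (rule sumset_Un)
    obtain l where l: "t = c * \<tau> + D * l" using sumset_progression[OF t] by blast
    have total: "n + \<phi> = s + (c * \<tau> + D * l) + i * u + j * v"
      using npq q12 q1_eq \<phi> pst l by simp
    show False
    proof (cases "2 \<le> i + j + c")
      case True
      have "s \<in> sumset (h - (i + j + c)) P" using s b_eq by simp
      moreover have "\<phi> \<le> h * k"
        using \<phi>(1) b b_eq by (meson le_trans le_add2 mult_le_mono1)
      ultimately have not_dvd: "\<not> int D dvd (int i - int (j * (h - 2))) * int u + (int j - 1) * int n + int (c * \<tau> + s) - int \<phi>"
        using True c b b_eq gen by (intro generic) auto
      have "int n + int \<phi> = int s + int c * int \<tau> + int D * int l + int i * int u + int j * int v"
        using arg_cong[OF total, of int] by simp
      moreover have "int j * int n = int j * (int (h - 2) * int u + int v)"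
        unfolding n by simp
      ultimately have "(int i - int (j * (h - 2))) * int u + (int j - 1) * int n + int (c * \<tau> + s) - int \<phi> = int D * (- int l)"
        unfolding of_nat_mult of_nat_add by algebra
      then show False using not_dvd by (metis dvd_triv_left)
    next
      case False
      then have c0: "c = 0" and ij: "(i = 1 \<and> j = 0) \<or> (i = 0 \<and> j = 1)"
        using gen(3) by auto
      have "s \<le> (h - b - c) * m" using sumset_le[OF le s] .
      also have "\<dots> \<le> h * m" by (intro mult_le_mono) auto
      finally have s_le: "s \<le> h * m" .
      from ij show False
      proof
        assume ij: "i = 1 \<and> j = 0"
        have "t = 0" using t c0 by simp
        then show False using npq q12 q1_eq pst \<phi> ij s_le size(2) by simp
      next
        assume ij: "i = 0 \<and> j = 1"
        have "1 * u \<le> (h - 2) * u" using ij gen(2) by (intro mult_le_mono) auto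
        moreover have "t = 0" using t c0 by simp
        then have "(h - 2) * u + \<phi> = s" using npq q12 q1_eq pst n \<phi> ij by simp
        ultimately show False using s_le size(1) by linarith
      qed
    qed
  qed
qed

section \<open>The sparse continuation of a set\<close>

text \<open>The length \<open>L\<close> of the initial block in stage \<open>k\<close>: congruent to \<open>1\<close> modulo \<open>fact (h\<^sup>2)\<close>, since all
coefficients that occur are at most \<open>h\<^sup>2\<close>, and large enough for every count of forbidden residues.
The factor \<open>k + 1\<close> is there because the markers bring in sums of elements of \<open>{..k}\<close>.\<close>

definition blocklen :: "nat \<Rightarrow> nat \<Rightarrow> nat" where
  "blocklen h k = 1 + fact (h\<^sup>2) * (8 * (h + 1) ^ (h + 5) * (k + 1))"

lemma blocklen_mono: "k \<le> k' \<Longrightarrow> blocklen h k \<le> blocklen h k'"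
  unfolding blocklen_def by (intro add_left_mono mult_le_mono) auto

lemma one_plus_fact_mod: "2 \<le> h \<Longrightarrow> (1 + fact (h\<^sup>2) * m) mod fact (h\<^sup>2) = (1::nat)"
proof -
  assume "2 \<le> h"
  then have "2\<^sup>2 \<le> h\<^sup>2" by (rule power_mono) simp
  then have "fact 4 \<le> (fact (h\<^sup>2) :: nat)" by (intro fact_mono) simp
  then have "1 < (fact (h\<^sup>2) :: nat)" by (simp add: fact_numeral)
  then have "1 mod fact (h\<^sup>2) = (1::nat)" by (rule mod_less)
  then show ?thesis by (metis mod_mult_self2)
qed

lemma blocklen_ge:
  assumes "2 \<le> h"
  shows "(h + 1) ^ 3 * (h * k + 1) * h ^ h < blocklen h k"
    and "4 * h ^ h + 4 * h\<^sup>2 + 8 \<le> blocklen h k"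
    and "100 * h\<^sup>2 + 100 * k + 100 \<le> blocklen h k"
proof -
  have fact1: "1 \<le> (fact (h\<^sup>2) :: nat)" by simp
  define B where "B = 8 * (h + 1) ^ (h + 5) * (k + 1)"
  have "1 * B \<le> fact (h\<^sup>2) * B"
    using fact1 by (rule mult_le_mono1)
  then have B: "B < blocklen h k" unfolding blocklen_def B_def by linarith
  have "(h + 1) ^ 3 * (h * k + 1) * h ^ h \<le> (h + 1) ^ 3 * ((h + 1) * (k + 1)) * (h + 1) ^ h"
    by (intro mult_le_mono power_mono) (auto simp: algebra_simps)
  also have "\<dots> = (h + 1) ^ (3 + 1 + h) * (k + 1)"
    by (simp only: power_add power_one_right mult_ac)
  also have "\<dots> \<le> (h + 1) ^ (h + 5) * (k + 1)"
    by (intro mult_le_mono1 power_increasing) auto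
  also have "\<dots> \<le> B" by (simp add: B_def)
  finally show "(h + 1) ^ 3 * (h * k + 1) * h ^ h < blocklen h k" using B by simp
  have h2: "h\<^sup>2 \<le> (h + 1)\<^sup>2" by (rule power_mono) auto
  have "(3::nat) ^ 5 \<le> (h + 1) ^ 5" using assms by (intro power_mono) auto
  then have five: "243 \<le> (h + 1) ^ 5" by simp
  have hh: "h ^ h \<le> (h + 1) ^ h" by (rule power_mono) auto
  have e: "(h + 1) ^ (h + 5) = (h + 1) ^ h * (h + 1) ^ 5" by (rule power_add)
  have sq: "(h + 1)\<^sup>2 \<le> (h + 1) ^ h" using assms by (intro power_increasing) auto
  have big: "(h + 1) ^ h * 243 \<le> (h + 1) ^ (h + 5)"
    unfolding e using five by (rule mult_le_mono2)
  have one: "1 \<le> (h + 1) ^ h" by simp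
  have "8 * (h + 1) ^ (h + 5) * 1 \<le> B" unfolding B_def by (intro mult_le_mono) auto
  then have B1: "1944 * (h + 1) ^ h \<le> B" using big by linarith
  then show "4 * h ^ h + 4 * h\<^sup>2 + 8 \<le> blocklen h k"
    using hh h2 sq one B by linarith
  have "8 * 243 * (k + 1) \<le> B"
    unfolding B_def using big one by (intro mult_le_mono) linarith+
  then have "200 * (k + 1) \<le> B" by simp
  moreover have "200 * h\<^sup>2 \<le> B" using B1 h2 sq by linarith
  ultimately show "100 * h\<^sup>2 + 100 * k + 100 \<le> blocklen h k"
    using B by simp
qed

text \<open>At the end of a stage \<open>{..N}\<close> is split into \<open>Y\<close>, about to be continued sparsely, and \<open>X\<close>, about to
receive almost everything.  The small elements of either set, at least \<open>h\<close> below \<open>2 * h\<close>, bridge the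
start of the next stage.  The block at the top of \<open>Y\<close> is the first rung of the ladder.
The inequality for \<open>N\<close> provides the room for the longer block required one stage later.\<close>

definition stage_inv :: "nat \<Rightarrow> nat \<Rightarrow> nat \<Rightarrow> nat set \<Rightarrow> nat set \<Rightarrow> bool" where
  "stage_inv h k N Y X \<longleftrightarrow>
     Y \<union> X = {..N} \<and> Y \<inter> X = {} \<and> h \<le> card (Y \<inter> {..<2 * h}) \<and> h \<le> card (X \<inter> {..<2 * h}) \<and>
     {N - blocklen h k<..N} \<subseteq> Y \<and> blocklen h (Suc k) + 2 * h\<^sup>2 \<le> N \<and>
     (\<forall>z. N + 2 * h\<^sup>2 \<le> z \<and> z \<le> 2 * N \<longrightarrow> z \<in> sumset h Y)"

text \<open>The hole \<open>n\<close> is the end of the block belonging to the \<open>h\<close>-th and last progression.  That progression is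
kept apart from the ladder because the markers must be generic for the modulus \<open>D\<close> that is its
difference.  The interval \<open>{\<alpha>..<\<alpha> + D}\<close> of sums of \<open>h - 1\<close> elements serves to continue beyond \<open>n\<close>.  Windows
of length \<open>blocklen h k\<close> contain at most one element of each of the \<open>h - 1\<close> progressions, and
the at most \<open>k + 2\<close> markers all lie far to the right.\<close>

lemma exists_thin_extension:
  fixes M :: nat
  assumes h: "2 \<le> h" and inv: "stage_inv h k N Y X" and F: "F \<subseteq> {..k}"
  obtains Z n \<alpha> D where
    "Z \<subseteq> {N<..n}" "\<alpha> + M \<le> n" "n \<notin> sumset h ((Y \<union> Z) - F)"
    "\<And>f. f \<in> F \<Longrightarrow> \<exists>s\<in>sumset (h - 1) (Y \<union> Z). n = f + s"
    "\<And>z. N + 2 * h\<^sup>2 \<le> z \<Longrightarrow> z < n \<Longrightarrow> z \<in> sumset h (Y \<union> Z)"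
    "{\<alpha>..<\<alpha> + D} \<subseteq> sumset (h - 1) (Y \<union> Z)" "blocklen h k \<le> D" "N + 1 \<le> \<alpha> + D" "0 < \<alpha>"
    "\<And>x. x \<le> 2 * N + blocklen h k \<Longrightarrow> card (Z \<inter> {x..<x + blocklen h k}) \<le> h - 1"
    "\<And>x. card (Z \<inter> {x..<x + blocklen h k}) \<le> h + k + 1"
proof -
  define L where "L = blocklen h k"
  define w where "w = N + 2 * h\<^sup>2 + 2"
  define K where "K = 1 + fact (h\<^sup>2) * (M + 20 * ((h + 1)\<^sup>2 * w))"
  have YX: "Y \<subseteq> {..N}" "{N - L<..N} \<subseteq> Y" "h \<le> card (Y \<inter> {..<2 * h})"
    and cover: "\<And>z. N + 2 * h\<^sup>2 \<le> z \<Longrightarrow> z \<le> 2 * N \<Longrightarrow> z \<in> sumset h Y"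
    using inv unfolding stage_inv_def L_def by blast+
  have "Y \<inter> {..<2 * h} \<noteq> {}" using YX(3) h by auto
  then obtain y where "y \<in> Y" "y < 2 * h" by blast
  then have y: "y \<in> Y" "y \<le> 2 * h" by simp_all
  have LN: "L \<le> N"
    using inv blocklen_mono[of k "Suc k" h] unfolding stage_inv_def L_def by simp
  note Lge = blocklen_ge[OF h, of k, folded L_def]
  have kN: "k < N" using Lge(3) LN by linarith
  have "1 * (M + 20 * ((h + 1)\<^sup>2 * w)) \<le> fact (h\<^sup>2) * (M + 20 * ((h + 1)\<^sup>2 * w))"
    by (rule mult_le_mono1) simp
  then have K_gt: "M + 20 * ((h + 1)\<^sup>2 * w) < K"
    unfolding K_def by (simp only: mult_1 plus_1_eq_Suc less_Suc_eq_le)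
  have hw: "(h + 1) * w \<le> (h + 1)\<^sup>2 * w"
    by (intro mult_le_mono1) (simp add: power2_eq_square)
  have w_le: "w \<le> (h + 1)\<^sup>2 * w" by simp
  have Lres: "L mod fact (h\<^sup>2) = 1" and Kres: "K mod fact (h\<^sup>2) = 1"
    unfolding L_def blocklen_def K_def by (rule one_plus_fact_mod[OF h])+
  have "(h + 1) * (N + 2 * h\<^sup>2 + 2) < K" using K_gt hw unfolding w_def by linarith
  moreover have "1 \<le> h - 1" "h - 1 < h" using h by auto
  ultimately obtain P \<alpha> where lad: "ladder h N Y L K (h - 1) P \<alpha>"
    using ladder_exists[OF YX(1,2) LN Lge(2) _ Lres Kres cover y] by blast
  define D where "D = L * K ^ (h - 2)"
  have Deq: "L * K ^ (h - 1 - 1) = D" by (simp add: D_def numeral_2_eq_2)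
  have P: "finite P" "Y \<subseteq> P" "\<forall>p\<in>P - Y. N < p" "\<forall>p\<in>P. p \<le> N + D"
      "card P \<le> N + 1 + (h - 1 - 1) * K" "{\<alpha>..<\<alpha> + D} \<subseteq> sumset (h - 1) P"
      "\<And>i. \<alpha> + D + i * D \<notin> sumset (h - 1) P" "N + 1 \<le> \<alpha> + D"
      "\<And>x. card ((P - Y) \<inter> {x..<x + L}) \<le> h - 1 - 1"
      "\<And>z. N + 2 * h\<^sup>2 \<le> z \<Longrightarrow> z \<le> \<alpha> + N + D div 2 + 2 * h\<^sup>2 \<Longrightarrow> z \<in> sumset h P"
    and \<alpha>0: "0 < \<alpha>"
    using lad unfolding ladder_def Deq by blast+
  have K1: "1 \<le> K" "N + 1 \<le> K" using K_gt w_le by (simp_all add: w_def)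
  have LD: "L \<le> D" using K1(1) unfolding D_def by simp
  have D0: "0 < D" using LD Lge(2) by linarith
  have cop: "coprime d (int D)" if "d \<noteq> 0" "\<bar>d\<bar> \<le> int (h\<^sup>2)" for d
    using coprime_of_mod_fact[OF that Lres] coprime_of_mod_fact[OF that Kres]
    by (simp add: D_def)
  have Pne: "P \<noteq> {}" using y P(2) by blast
  have h1: "1 \<le> h - 1" "h - 1 \<le> h" using h by auto
  have cardP: "card P ^ (h - 2) \<le> h ^ (h - 2) * K ^ (h - 2)"
    using card_power_bound(2)[OF h1 K1 P(5)] .
  have hh2: "h ^ (h - 2) \<le> h ^ h" using h by (intro power_increasing) auto
  have K0: "0 < K ^ (h - 2)" using K1 by simp
  have "(h - 1) * card P ^ (h - 1 - 1) \<le> h * (h ^ (h - 2) * K ^ (h - 2))"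
    using cardP by (intro mult_le_mono) (auto simp: numeral_2_eq_2)
  also have "\<dots> = h ^ (h - 1) * K ^ (h - 2)"
  proof -
    have "h - 1 = Suc (h - 2)" using h by simp
    then show ?thesis by simp
  qed
  also have "\<dots> \<le> h ^ h * K ^ (h - 2)"
    using h by (intro mult_le_mono1 power_increasing) auto
  finally have 1: "(h - 1) * card P ^ (h - 1 - 1) \<le> h ^ h * K ^ (h - 2)" .
  have "(4 * h ^ h + 4) * K ^ (h - 2) \<le> D"
    unfolding D_def using Lge(2) by (intro mult_le_mono1) linarith
  then have "4 * (h ^ h * K ^ (h - 2)) + 4 * K ^ (h - 2) \<le> D"
    by (simp only: add_mult_distrib mult.assoc)
  then have card1: "(h - 1) * card P ^ (h - 1 - 1) < D div 2"
    using 1 K0 by linarith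
  have cop1: "coprime (int c) (int D)" if "1 \<le> c" "c \<le> h - 1" for c
  proof (rule cop)
    have "c * 1 \<le> h * h" using that h by (intro mult_le_mono) auto
    then show "\<bar>int c\<bar> \<le> int (h\<^sup>2)"
      by (simp add: power2_eq_square flip: of_nat_mult)
  qed (use that in simp)
  obtain \<tau> where \<tau>: "N < \<tau>" "\<tau> \<le> N + D div 2"
    "\<And>c s. 1 \<le> c \<Longrightarrow> c \<le> h - 1 \<Longrightarrow> s \<in> sumset (h - 1 - c) P \<Longrightarrow> \<not> int D dvd int (c * \<tau> + s) - int \<alpha>"
    using exists_generic_offset[OF P(1) Pne h1(1) cop1 card1, of N \<alpha>] by blast
  define n where "n = \<alpha> + \<tau> + D * K"
  define W where "W = h * (N + D)"
  have "(h + 1) ^ 3 * (h * k + 1) * card P ^ (h - 2) \<le> (h + 1) ^ 3 * (h * k + 1) * (h ^ h * K ^ (h - 2))"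
    using cardP hh2 by (intro mult_le_mono2) (meson le_trans mult_le_mono1)
  also have "\<dots> = ((h + 1) ^ 3 * (h * k + 1) * h ^ h) * K ^ (h - 2)" by (simp only: mult.assoc)
  also have "\<dots> < D"
    unfolding D_def using Lge(1) K0 by (rule mult_less_mono1)
  finally have card2: "(h + 1) ^ 3 * (h * k + 1) * card P ^ (h - 2) < D" .
  obtain u where u: "W < u" "u \<le> W + D"
    "\<And>i j c \<phi> s. 2 \<le> i + j + c \<Longrightarrow> i + j + c \<le> h \<Longrightarrow> i \<noteq> j * (h - 2) \<Longrightarrow> \<phi> \<le> h * k \<Longrightarrow>
       s \<in> sumset (h - (i + j + c)) P \<Longrightarrow>
       \<not> int D dvd (int i - int (j * (h - 2))) * int u + (int j - 1) * int n + int (c * \<tau> + s) - int \<phi>"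
    using exists_generic_summand[OF P(1) Pne h cop card2, of W n \<tau>] by blast
  \<comment> \<open>\<open>E\<close> bounds \<open>u\<close> and \<open>(h - 2) * u\<close>, whereas \<open>n\<close> exceeds \<open>20 * E\<close>; hence \<open>u\<close> is small against \<open>v\<close>\<close>
  define E where "E = D * ((h + 1)\<^sup>2 * w)"
  have DK: "20 * E + M \<le> D * K"
  proof -
    have "D * (M + 20 * ((h + 1)\<^sup>2 * w)) \<le> D * K"
      using K_gt by (intro mult_le_mono2) simp
    moreover have "M \<le> D * M" using D0 by simp
    ultimately have "D * (20 * ((h + 1)\<^sup>2 * w)) + M \<le> D * K"
      unfolding add_mult_distrib2 by linarith
    then show ?thesis unfolding E_def by (simp only: mult.left_commute[of D 20])
  qed
  have u_le: "u \<le> D * ((h + 1) * w)"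
  proof -
    have "h * N * 1 \<le> h * N * D" using D0 by (intro mult_le_mono2) simp
    then have "W + D \<le> D * (h * N + h + 1)" by (simp add: W_def algebra_simps)
    also have "\<dots> \<le> D * ((h + 1) * w)" by (intro mult_le_mono2) (simp add: w_def algebra_simps)
    finally show ?thesis using u(2) by simp
  qed
  have "D * ((h + 1) * w) \<le> E" unfolding E_def using hw by (rule mult_le_mono2)
  then have uE: "u \<le> E" using u_le by simp
  have "(h - 2) * u \<le> (h + 1) * (D * ((h + 1) * w))"
    using u_le by (intro mult_le_mono) auto
  also have "\<dots> = E" unfolding E_def power2_eq_square by (simp only: mult_ac)
  finally have huE: "(h - 2) * u \<le> E" .
  have "2 * N + 2 * D \<le> W" unfolding W_def using h by (metis add_mult_distrib2 mult_le_mono1)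
  then have big_u: "2 * N + 2 * D < u" using u(1) by simp
  have D_E: "D \<le> E" using uE big_u by simp
  define v where "v = n - (h - 2) * u"
  have n_ge: "20 * E + M \<le> n" using DK by (simp add: n_def)
  have nv: "n = (h - 2) * u + v" unfolding v_def using huE n_ge by simp
  have v_big: "19 * E \<le> v" using nv huE n_ge by simp
  define T where "T = progression \<tau> D K"
  define U where "U = {u} \<union> (\<lambda>f. v - f) ` F"
  define Z where "Z = (P - Y) \<union> T \<union> U"
  have YZ: "Y \<union> Z = P \<union> T \<union> U" using P(2) by (auto simp: Z_def)
  have Fk: "\<forall>f\<in>F. f \<le> k" using F by auto
  have hole: "n \<notin> sumset h (P \<union> T)"
  proof -
    have "(h - 1 + 1) * (N + D) < D * K"
      using h u(1) uE DK D_E D0 unfolding W_def by simp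
    then have "\<alpha> + \<tau> + D * K + 0 * (D * K) \<notin> sumset (Suc (h - 1)) (P \<union> progression \<tau> D K)"
      by (intro progression_keeps_exact_end[where m = "N + D"] D0 P(4,7) \<tau>(3)) auto
    then show ?thesis using h by (simp add: n_def T_def)
  qed
  have "n \<notin> sumset h ((P \<union> T \<union> U) - F)"
    unfolding T_def U_def
  proof (rule hole_survives_markers[OF h nv _ Fk P(4)])
    show "h * (N + D) < u" using u(1) by (simp add: W_def)
    show "u + h * (N + D) < n" using u(1) uE n_ge D_E D0 by (simp add: W_def)
    show "k < u" using kN big_u by simp
    show "2 * k < v" using kN big_u v_big uE by simp
  qed (use hole u(3) in \<open>auto simp: T_def\<close>)
  then have c: "n \<notin> sumset h ((Y \<union> Z) - F)" by (simp add: YZ)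
  have T_range: "N < p \<and> p \<le> n" if "p \<in> T" for p
  proof -
    from that obtain i where i: "i < K" "p = \<tau> + D * i"
      unfolding T_def progression_def by blast
    have "D * i \<le> D * K" using i(1) by (intro mult_le_mono2) simp
    then show ?thesis using i(2) \<tau>(1) unfolding n_def by linarith
  qed
  have U_range: "2 * N + 2 * D < p \<and> p \<le> n" if "p \<in> U" for p
  proof -
    from that consider "p = u" | f where "f \<in> F" "p = v - f" by (auto simp: U_def)
    then show ?thesis
    proof cases
      case 1
      then show ?thesis using big_u uE n_ge by simp
    next
      case 2
      then have "f \<le> k" using Fk by blast
      moreover have "2 * N + 2 * D + k < v" using v_big uE big_u kN by linarith
      moreover have "v \<le> n" unfolding nv by simp
      ultimately show ?thesis using 2 by linarith
    qed
  qed
  have P_range: "N < p \<and> p \<le> n" if "p \<in> P - Y" for p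
    using that P(3,4) n_ge D_E big_u uE by fastforce
  show ?thesis
  proof (rule that[of Z n \<alpha> D])
    show "Z \<subseteq> {N<..n}"
      using T_range U_range P_range unfolding Z_def by fastforce
    show "\<alpha> + M \<le> n" using DK by (simp add: n_def)
    show "n \<notin> sumset h ((Y \<union> Z) - F)" by (rule c)
    show "\<exists>s\<in>sumset (h - 1) (Y \<union> Z). n = f + s" if "f \<in> F" for f
    proof -
      have "u \<in> Y \<union> Z" "v - f \<in> Y \<union> Z" using that by (auto simp: YZ U_def)
      then have "(h - 2) * u + (v - f) \<in> sumset (h - 2 + 1) (Y \<union> Z)"
        by (intro sumset_add sumset_mult) auto
      moreover have "h - 2 + 1 = h - 1" using h by simp
      moreover have "f \<le> v" using that Fk kN v_big uE big_u by fastforce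
      ultimately show ?thesis using nv by (metis add.left_commute le_add_diff_inverse)
    qed
    show "z \<in> sumset h (Y \<union> Z)" if "N + 2 * h\<^sup>2 \<le> z" "z < n" for z
    proof (cases "z \<le> \<alpha> + N + D div 2 + 2 * h\<^sup>2")
      case True
      then show ?thesis using P(10)[OF that(1)] sumset_mono[of P "Y \<union> Z" h] YZ by auto
    next
      case False
      then have "z \<in> {\<alpha> + \<tau>..<\<alpha> + \<tau> + D * K}" using \<tau>(2) that(2) by (simp add: n_def)
      then have "z \<in> sumset (Suc (h - 1)) (P \<union> T)"
        unfolding T_def using progression_extends_block[OF D0 P(6)] by blast
      then show ?thesis using sumset_mono[of "P \<union> T" "Y \<union> Z" h] YZ h by auto
    qed
    show "{\<alpha>..<\<alpha> + D} \<subseteq> sumset (h - 1) (Y \<union> Z)"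
      using P(6) sumset_mono[of P "Y \<union> Z" "h - 1"] YZ by blast
    show "blocklen h k \<le> D" using LD by (simp add: L_def)
    show "N + 1 \<le> \<alpha> + D" "0 < \<alpha>" by (rule P(8) \<alpha>0)+
    have PT: "card ((P - Y \<union> T) \<inter> {x..<x + L}) \<le> h - 1" for x
    proof -
      have "card ((P - Y \<union> T) \<inter> {x..<x + L}) \<le> card ((P - Y) \<inter> {x..<x + L}) + card (T \<inter> {x..<x + L})"
        using card_Un_le[of "(P - Y) \<inter> {x..<x + L}" "T \<inter> {x..<x + L}"] by (simp add: Int_Un_distrib2)
      also have "\<dots> \<le> (h - 1 - 1) + 1"
        unfolding T_def by (intro add_mono P(9) card_progression_window LD)
      finally show ?thesis using h by simp
    qed
    show "card (Z \<inter> {x..<x + blocklen h k}) \<le> h - 1" if "x \<le> 2 * N + blocklen h k" for x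
    proof -
      have "U \<inter> {x..<x + L} = {}"
        using U_range that LD by (fastforce simp: L_def)
      then have "Z \<inter> {x..<x + L} = (P - Y \<union> T) \<inter> {x..<x + L}" by (auto simp: Z_def)
      then show ?thesis using PT by (simp add: L_def)
    qed
    show "card (Z \<inter> {x..<x + blocklen h k}) \<le> h + k + 1" for x
    proof -
      have finF: "finite F" using F finite_subset by blast
      have finU: "finite U" using finF by (simp add: U_def)
      have "card F \<le> k + 1" using card_mono[OF _ F] by simp
      then have "card U \<le> 1 + (k + 1)"
        using card_Un_le[of "{u}" "(\<lambda>f. v - f) ` F"] card_image_le[OF finF, of "\<lambda>f. v - f"]
        by (simp add: U_def)
      then have "card (U \<inter> {x..<x + L}) \<le> k + 2"
        using card_mono[OF finU, of "U \<inter> {x..<x + L}"] by simp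
      moreover have "card (Z \<inter> {x..<x + L}) \<le> card ((P - Y \<union> T) \<inter> {x..<x + L}) + card (U \<inter> {x..<x + L})"
        using card_Un_le[of "(P - Y \<union> T) \<inter> {x..<x + L}" "U \<inter> {x..<x + L}"]
        by (simp add: Z_def Int_Un_distrib2)
      ultimately show ?thesis using PT[of x] h by (simp add: L_def)
    qed
  qed
qed

section \<open>One stage of the construction\<close>

text \<open>Among \<open>2 * w\<close> consecutive values of \<open>y\<close>, fewer than \<open>w\<close> lie in \<open>Z\<close> and fewer than \<open>w\<close> have \<open>z - y\<close> in \<open>Z\<close>.\<close>

lemma exists_pair_avoiding:
  fixes Z :: "nat set"
  assumes win: "\<And>x. card (Z \<inter> {x..<x + L}) < w" and w: "2 * w \<le> L" and z: "a + 2 * w \<le> z + 1"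
  obtains y where "a \<le> y" "y < a + 2 * w" "y \<notin> Z" "z - y \<notin> Z"
proof -
  let ?C = "{a..<a + 2 * w}" and ?b = "z + 1 - (a + 2 * w)"
  let ?B1 = "Z \<inter> ?C" and ?B2 = "{y \<in> ?C. z - y \<in> Z}"
  have "card ?B1 \<le> card (Z \<inter> {a..<a + L})"
    using w by (intro card_mono) auto
  moreover have "card ?B2 \<le> card (Z \<inter> {?b..<?b + L})"
  proof (rule card_inj_on_le)
    show "inj_on (\<lambda>y. z - y) ?B2" using z by (auto simp: inj_on_def)
    show "(\<lambda>y. z - y) ` ?B2 \<subseteq> Z \<inter> {?b..<?b + L}" using z w by auto
  qed auto
  ultimately have "card (?B1 \<union> ?B2) < card ?C"
    using win[of a] win[of ?b] card_Un_le[of ?B1 ?B2] by simp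
  then have "\<not> ?C \<subseteq> ?B1 \<union> ?B2"
    using card_mono[of "?B1 \<union> ?B2" ?C] by fastforce
  then obtain y where "y \<in> ?C" "y \<notin> ?B1 \<union> ?B2" by blast
  then show ?thesis using that[of y] by auto
qed

lemma sumset_two_more:
  assumes "2 \<le> h" "x \<in> A" "a \<in> A" "b \<in> A"
  shows "(h - 2) * x + (a + b) \<in> sumset h A"
proof -
  have "a + b \<in> sumset 2 A"
    using sumset_SucI[of a A b 1] assms by (simp add: numeral_2_eq_2)
  then have "(h - 2) * x + (a + b) \<in> sumset (h - 2 + 2) A"
    using assms by (intro sumset_add sumset_mult)
  moreover have "h - 2 + 2 = h" using assms(1) by simp
  ultimately show ?thesis by metis
qed

text \<open>Here \<open>Z\<close> is the sparse set withheld from \<open>A\<close>.  Let \<open>z'\<close> be what remains of \<open>z\<close> after subtracting \<open>h - 2\<close>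
copies of a small element; it has to be a sum of two elements of \<open>A\<close>.  Close to \<open>N\<close> one of the \<open>h\<close>
small elements works as the first summand, since a window contains at most \<open>h - 1\<close> elements of \<open>Z\<close>.
Beyond that, there is a pair avoiding \<open>Z\<close> with its first summand near \<open>z' / 2\<close>, or, as \<open>z'\<close> grows, in the
final interval \<open>{n + \<alpha><..N'}\<close>; at the very end both summands come from this interval.\<close>

lemma full_side_covers:
  fixes X Z :: "nat set"
  assumes h: "2 \<le> h" and A: "X \<subseteq> A" "{N<..R} - Z \<subseteq> A" "{n + \<alpha><..N'} \<subseteq> A"
    and X: "h \<le> card (X \<inter> {..<2 * h})"
    and Z: "\<And>x. x \<le> 2 * N + L \<Longrightarrow> card (Z \<inter> {x..<x + L}) \<le> h - 1"
      "\<And>x. card (Z \<inter> {x..<x + L}) \<le> h + k + 1"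
    and size: "100 * h\<^sup>2 + 100 * k + 100 \<le> L" "n \<le> R + 2 * h\<^sup>2" "L \<le> N"
      "\<alpha> + 10 * N \<le> n" "N' = n + 2 * \<alpha> + D - 1 - 2 * h\<^sup>2" "L \<le> D"
    and z: "N + 2 * h\<^sup>2 < z" "z \<le> 2 * N'"
  shows "z \<in> sumset h A"
proof -
  define w where "w = h + k + 2"
  define S where "S = 2 * h\<^sup>2"
  have "1 * h \<le> h\<^sup>2" using h by (simp add: power2_eq_square)
  then have hS: "2 * h \<le> S" by (simp add: S_def)
  have w_small: "20 * S + 10 * w \<le> L" "1 \<le> w" using size(1) hS by (simp_all add: w_def S_def)
  have nR: "n \<le> R + S" and zS: "N + S < z" and N': "N' = n + 2 * \<alpha> + D - 1 - S"
    using size z by (simp_all add: S_def)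
  have "X \<inter> {..<2 * h} \<noteq> {}" using X h by auto
  then obtain x0 where x0: "x0 \<in> X" "x0 < 2 * h" by blast
  have shift: "(h - 2) * x0 + 2 * h \<le> S"
  proof -
    have "(h - 2) * x0 \<le> (h - 2) * (2 * h)" using x0(2) by (intro mult_le_mono2) simp
    moreover have "(h - 2) * (2 * h) + 2 * h \<le> h * (2 * h)"
    proof -
      have "(h - 2) * (2 * h) + 2 * h = (h - 2 + 1) * (2 * h)"
        by (simp only: add_mult_distrib mult_1)
      also have "\<dots> \<le> h * (2 * h)" using h by (intro mult_le_mono1) simp
      finally show ?thesis .
    qed
    moreover have "h * (2 * h) = S" by (simp add: S_def power2_eq_square)
    ultimately show ?thesis by linarith
  qed
  define z' where "z' = z - (h - 2) * x0"
  have zz: "z = (h - 2) * x0 + z'" using shift zS by (simp add: z'_def)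
  have z'_bd: "N + S < z' + S" "N + 2 * h < z'" "z' \<le> 2 * N'" "z \<le> z' + S"
    using shift zS z(2) by (simp_all add: z'_def)
  have pair: "z \<in> sumset h A" if "a \<in> A" "b \<in> A" "a + b = z'" for a b
    using sumset_two_more[OF h, of x0 A a b] that x0(1) A(1) zz by blast
  have win: "card (Z \<inter> {x..<x + L}) < w" for x
    using Z(2)[of x] by (simp add: w_def)
  have avoid: thesis if "a + 2 * w \<le> z' + 1"
      "\<And>y. a \<le> y \<Longrightarrow> y < a + 2 * w \<Longrightarrow> y \<notin> Z \<Longrightarrow> z' - y \<notin> Z \<Longrightarrow> thesis" for a thesis
    using exists_pair_avoiding[of Z L w a z'] win w_small that by auto
  have inR: "y \<in> A" if "N < y" "y \<le> R" "y \<notin> Z" for y using that A(2) by auto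
  have inI: "y \<in> A" if "n + \<alpha> < y" "y \<le> N'" for y using that A(3) by auto
  consider "z \<le> 2 * N + L" | "2 * N + L < z" "z' + 2 * w + 2 \<le> 2 * R"
    | "2 * R < z' + 2 * w + 2" "z' \<le> R + n + \<alpha>"
    | "R + n + \<alpha> < z'" "z' + 2 * w \<le> R + N' + 1" | "R + N' + 1 < z' + 2 * w"
    by linarith
  then show ?thesis
  proof cases
    case 1
    define a where "a = z' - (2 * h - 1)"
    have a: "N < a" "a \<le> 2 * N + L" "z' = a + (2 * h - 1)"
      using z'_bd 1 h by (simp_all add: a_def z'_def)
    let ?Q = "(\<lambda>x. z' - x) ` (X \<inter> {..<2 * h})"
    have "inj_on (\<lambda>x. z' - x) (X \<inter> {..<2 * h})"
      using z'_bd by (auto simp: inj_on_def)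
    then have cardQ: "h \<le> card ?Q" using X by (simp add: card_image)
    have "\<not> ?Q \<subseteq> Z"
    proof
      assume "?Q \<subseteq> Z"
      moreover have "?Q \<subseteq> {a..<a + L}" using a w_small hS h by auto
      ultimately have "card ?Q \<le> card (Z \<inter> {a..<a + L})" by (intro card_mono) auto
      then show False using cardQ Z(1)[OF a(2)] h by simp
    qed
    then obtain x where x: "x \<in> X" "x < 2 * h" "z' - x \<notin> Z" by auto
    have "z' - x \<in> A"
    proof (rule inR)
      show "N < z' - x" using z'_bd x(2) by simp
      have "z' \<le> z" by (simp add: z'_def)
      then show "z' - x \<le> R" using 1 nR size(3,4) w_small by linarith
    qed (rule x(3))
    then show ?thesis using pair[of x "z' - x"] x z'_bd A(1) by auto
  next
    case 2
    define a where "a = z' div 2 - w"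
    have "2 * N + 2 * w + 2 \<le> z'" using 2 z'_bd w_small hS h by linarith
    then have "N + w + 1 \<le> z' div 2" by linarith
    then have a: "N < a" "z' div 2 = a + w" by (simp_all add: a_def)
    have "a + 2 * w \<le> z' + 1" using a w_small 2 z'_bd by linarith
    then obtain y where y: "a \<le> y" "y < a + 2 * w" "y \<notin> Z" "z' - y \<notin> Z"
      by (rule avoid)
    have "y \<in> A" using y a 2 by (intro inR) linarith+
    moreover have "z' - y \<in> A" using y a 2 by (intro inR) linarith+
    ultimately show ?thesis using pair[of y "z' - y"] y a by linarith
  next
    case 3
    have "n + \<alpha> + 1 + 2 * w \<le> z' + 1" using 3 nR w_small size(3,4) by linarith
    then obtain y where y: "n + \<alpha> + 1 \<le> y" "y < n + \<alpha> + 1 + 2 * w" "y \<notin> Z" "z' - y \<notin> Z"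
      by (rule avoid)
    have "y \<in> A" using y N' w_small size(6) by (intro inI) linarith+
    moreover have "z' - y \<in> A" using y 3 nR w_small size(3,4) by (intro inR) linarith+
    ultimately show ?thesis using pair[of y "z' - y"] y 3 nR w_small size(3,4) by linarith
  next
    case 4
    define a where "a = z' - R"
    have a: "z' = a + R" "n + \<alpha> < a" using 4 by (simp_all add: a_def)
    have R2w: "N + 2 * w < R" using nR size(3,4) w_small by linarith
    have "a + 2 * w \<le> z' + 1" using a R2w by linarith
    then obtain y where y: "a \<le> y" "y < a + 2 * w" "y \<notin> Z" "z' - y \<notin> Z"
      by (rule avoid)
    have "y \<in> A" using y a 4 by (intro inI) linarith+
    moreover have "z' - y \<in> A" using y a R2w by (intro inR) linarith+
    ultimately show ?thesis using pair[of y "z' - y"] y a R2w by linarith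
  next
    case 5
    have "N' + S + 1 = n + 2 * \<alpha> + D" using N' w_small size(6) by simp
    then have "2 * n + 2 * \<alpha> + 2 \<le> z'" using 5 nR w_small size(6) by linarith
    then have "n + \<alpha> < z' div 2" "n + \<alpha> < z' - z' div 2" by linarith+
    moreover have "z' div 2 \<le> N'" "z' - z' div 2 \<le> N'" using z'_bd(3) by linarith+
    ultimately have "z' div 2 \<in> A" "z' - z' div 2 \<in> A" using inI by blast+
    then show ?thesis by (rule pair) simp
  qed
qed

text \<open>After the hole \<open>n\<close> the sparse set receives an interval ending at \<open>n + \<alpha>\<close>.  With \<open>y0\<close> the least element,
the interval starts at \<open>n + 1 - (h - 1) * y0\<close>: then \<open>n + 1\<close> is represented, but \<open>n\<close> is not.
Adding the block \<open>{\<alpha>..<\<alpha> + D}\<close> of sums of \<open>h - 1\<close> elements to the interval covers everything up to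
\<open>n + 2 * \<alpha> + D - 1\<close>.  Meanwhile the other set can be given all of \<open>{n + \<alpha><..N'}\<close>, which is the block that
it needs for exchanging the roles.\<close>

lemma exists_next_stage:
  assumes h: "2 \<le> h" and inv: "stage_inv h k N Y X" and F: "F \<subseteq> {..k}"
  shows "\<exists>n N' Y' X'. stage_inv h (Suc k) N' X' Y' \<and> N < n \<and> n \<le> N' \<and> Y \<subseteq> Y' \<and> X \<subseteq> X' \<and>
           n \<notin> sumset h (Y' - F) \<and> (\<forall>f\<in>F. \<exists>s\<in>sumset (h - 1) Y'. n = f + s) \<and>
           (\<forall>z. N + 2 * h\<^sup>2 < z \<and> z \<le> N' + 2 * h\<^sup>2 \<and> z \<noteq> n \<longrightarrow> z \<in> sumset h Y') \<and>
           (\<forall>z. N + 2 * h\<^sup>2 < z \<and> z \<le> N' + 2 * h\<^sup>2 \<longrightarrow> z \<in> sumset h X')"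
proof -
  define S where "S = 2 * h\<^sup>2"
  define L where "L = blocklen h k"
  define M where "M = 20 * N + 10 * S + blocklen h (Suc (Suc k))"
  have I: "Y \<union> X = {..N}" "Y \<inter> X = {}" "h \<le> card (Y \<inter> {..<2 * h})" "h \<le> card (X \<inter> {..<2 * h})"
      "{N - L<..N} \<subseteq> Y" "blocklen h (Suc k) + S \<le> N"
    using inv unfolding stage_inv_def L_def S_def by blast+
  have LN: "L \<le> N" using I(6) blocklen_mono[of k "Suc k" h] by (simp add: L_def)
  note Lge = blocklen_ge(3)[OF h, of k, folded L_def]
  obtain Z n \<alpha> D where A:
    "Z \<subseteq> {N<..n}" "\<alpha> + M \<le> n" "n \<notin> sumset h ((Y \<union> Z) - F)"
    "\<And>f. f \<in> F \<Longrightarrow> \<exists>s\<in>sumset (h - 1) (Y \<union> Z). n = f + s"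
    "\<And>z. N + 2 * h\<^sup>2 \<le> z \<Longrightarrow> z < n \<Longrightarrow> z \<in> sumset h (Y \<union> Z)"
    "{\<alpha>..<\<alpha> + D} \<subseteq> sumset (h - 1) (Y \<union> Z)" "L \<le> D" "N + 1 \<le> \<alpha> + D" "0 < \<alpha>"
    "\<And>x. x \<le> 2 * N + L \<Longrightarrow> card (Z \<inter> {x..<x + L}) \<le> h - 1"
    "\<And>x. card (Z \<inter> {x..<x + L}) \<le> h + k + 1"
    unfolding L_def by (rule exists_thin_extension[OF h inv F, of M]) blast
  define y0 where "y0 = (LEAST y. y \<in> Y)"
  have "Y \<inter> {..<2 * h} \<noteq> {}" using I(3) h by auto
  then obtain y1 where y1: "y1 \<in> Y" "y1 < 2 * h" by blast
  have y0: "y0 \<in> Y" "\<And>y. y \<in> Y \<Longrightarrow> y0 \<le> y"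
    unfolding y0_def using y1(1) by (auto intro: LeastI Least_le)
  have "y0 \<le> 2 * h" using y0(2)[OF y1(1)] y1(2) by simp
  then have "(h - 1) * y0 \<le> h * (2 * h)" by (intro mult_le_mono) auto
  then have hy0: "(h - 1) * y0 \<le> S" by (simp add: S_def power2_eq_square)
  define R where "R = n - (h - 1) * y0"
  define N' where "N' = n + 2 * \<alpha> + D - 1 - S"
  define Y' where "Y' = Y \<union> Z \<union> {R<..n + \<alpha>}"
  define X' where "X' = X \<union> ({N<..R} - Z) \<union> {n + \<alpha><..N'}"
  have SL: "S + 10 \<le> L" using Lge by (simp add: S_def)
  have R: "R \<le> n" "n = R + (h - 1) * y0" "n \<le> R + S" "N < R"
    using hy0 A(2) SL LN by (simp_all add: R_def M_def)
  have aM: "\<alpha> + 20 * N + 10 * S \<le> n" using A(2) by (simp add: M_def)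
  have N'_top: "blocklen h (Suc k) \<le> N' - (n + \<alpha>)" "L \<le> blocklen h (Suc k)"
    using A(7,8) I(6) SL blocklen_mono[of k "Suc k" h] by (simp_all add: N'_def L_def)
  have N'_ge: "n + \<alpha> + 10 \<le> N'" "n \<le> N'" "N < n" "N < N'"
    using SL A(7,8) R(1,4) aM LN I(6) N'_top by linarith+
  have cov_Y: "z \<in> sumset h Y'" if z: "N + S < z" "z \<le> N' + S" "z \<noteq> n" for z
  proof -
    have Y'Z: "sumset i (Y \<union> Z) \<subseteq> sumset i Y'" for i
      by (intro sumset_mono) (auto simp: Y'_def)
    have h1: "1 + (h - 1) = h" using h by simp
    consider "z < n" | "n < z" "z \<le> n + \<alpha> + (h - 1) * y0" | "n + \<alpha> + (h - 1) * y0 < z"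
      using z(3) by linarith
    then show ?thesis
    proof cases
      case 1
      then show ?thesis using A(5)[of z] z(1) Y'Z by (auto simp: S_def)
    next
      case 2
      define e where "e = z - (h - 1) * y0"
      have e: "z = e + (h - 1) * y0" "R < e" "e \<le> n + \<alpha>" using 2 R(2) by (simp_all add: e_def)
      have "e \<in> sumset 1 Y'" using e by (simp add: Y'_def)
      moreover have "(h - 1) * y0 \<in> sumset (h - 1) Y'" using y0 by (intro sumset_mult) (simp add: Y'_def)
      ultimately have "e + (h - 1) * y0 \<in> sumset (1 + (h - 1)) Y'" by (rule sumset_add)
      then show ?thesis using e h1 by simp
    next
      case 3
      have D0: "0 < D" using A(7) SL by simp
      have zN: "z \<le> n + 2 * \<alpha> + D - 1" using z(2) A(2,7) SL by (simp add: N'_def)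
      \<comment> \<open>the interval is nonempty at its right end because \<open>0 < \<alpha>\<close>\<close>
      obtain e s where es: "z = e + s" "R < e" "e \<le> n + \<alpha>" "\<alpha> \<le> s" "s < \<alpha> + D"
      proof (cases "z \<le> n + 2 * \<alpha>")
        case True
        then show ?thesis using that[of "z - \<alpha>" \<alpha>] 3 R D0 by simp
      next
        case False
        show ?thesis
          by (rule that[of "n + \<alpha>" "z - (n + \<alpha>)"])
             (use False zN R(1) D0 A(9) in linarith)+
      qed
      have "e \<in> sumset 1 Y'" using es by (simp add: Y'_def)
      moreover have "s \<in> sumset (h - 1) Y'" using es A(6) Y'Z by force
      ultimately have "e + s \<in> sumset (1 + (h - 1)) Y'" by (rule sumset_add)
      then show ?thesis using es h1 by simp
    qed
  qed
  have cov_X: "z \<in> sumset h X'" if z: "N + S < z" "z \<le> 2 * N'" for z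
  proof (rule full_side_covers[OF h _ _ _ I(4) A(10,11)])
    show "100 * h\<^sup>2 + 100 * k + 100 \<le> L" by (rule Lge)
    show "n \<le> R + 2 * h\<^sup>2" "N + 2 * h\<^sup>2 < z" using R z by (simp_all add: S_def)
    show "N' = n + 2 * \<alpha> + D - 1 - 2 * h\<^sup>2" by (simp add: N'_def S_def)
    show "\<alpha> + 10 * N \<le> n" using A(2) by (simp add: M_def)
  qed (use R LN A(7) z in \<open>auto simp: X'_def\<close>)
  have no_hole: "n \<notin> sumset h (Y' - F)"
  proof
    assume "n \<in> sumset h (Y' - F)"
    moreover have "\<forall>y\<in>Y' - F. y0 \<le> y"
    proof -
      have "y0 \<le> N" using y0(1) I(1) by auto
      then show ?thesis using y0(2) A(1) R(4) by (fastforce simp: Y'_def)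
    qed
    moreover have "n \<le> (h - 1) * y0 + R" using R(2) by simp
    ultimately have "n \<in> sumset h {y \<in> Y' - F. y \<le> R}" by (intro sumset_restrict)
    moreover have "{y \<in> Y' - F. y \<le> R} \<subseteq> (Y \<union> Z) - F" by (auto simp: Y'_def)
    ultimately have "n \<in> sumset h ((Y \<union> Z) - F)"
      by (meson sumset_mono subsetD)
    then show False using A(3) by simp
  qed
  have part: "X' \<union> Y' = {..N'}" "X' \<inter> Y' = {}"
  proof -
    have XN: "X \<subseteq> {..N}" "Y \<subseteq> {..N}" using I(1) by auto
    show "X' \<inter> Y' = {}"
      using XN I(2) A(1) R(1,4) N'_ge by (fastforce simp: X'_def Y'_def)
    have "z \<in> X' \<union> Y'" if "z \<le> N'" for z
    proof (cases "z \<le> N")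
      case True
      then have "z \<in> Y \<union> X" unfolding I(1) by simp
      then show ?thesis by (auto simp: X'_def Y'_def)
    next
      case False
      then show ?thesis using that unfolding X'_def Y'_def by auto
    qed
    moreover have "X' \<union> Y' \<subseteq> {..N'}"
      using XN A(1) R(1,4) N'_ge by (fastforce simp: X'_def Y'_def)
    ultimately show "X' \<union> Y' = {..N'}" by auto
  qed
  have card_mono': "h \<le> card (B' \<inter> {..<2 * h})" if "h \<le> card (B \<inter> {..<2 * h})" "B \<subseteq> B'" for B B' :: "nat set"
    using that card_mono[of "B' \<inter> {..<2 * h}" "B \<inter> {..<2 * h}"] by (meson Int_mono finite_Int finite_lessThan le_trans order_refl)
  have "stage_inv h (Suc k) N' X' Y'"
    unfolding stage_inv_def
  proof (intro conjI allI impI)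
    show "h \<le> card (X' \<inter> {..<2 * h})" "h \<le> card (Y' \<inter> {..<2 * h})"
      by (rule card_mono'[OF I(4)] card_mono'[OF I(3)], auto simp: X'_def Y'_def)+
    show "{N' - blocklen h (Suc k)<..N'} \<subseteq> X'"
      using N'_top(1) by (auto simp: X'_def)
    show "blocklen h (Suc (Suc k)) + 2 * h\<^sup>2 \<le> N'"
      using N'_ge A(2) by (simp add: M_def S_def)
    show "z \<in> sumset h X'" if "N' + 2 * h\<^sup>2 \<le> z \<and> z \<le> 2 * N'" for z
      using cov_X[of z] that N'_ge by (simp add: S_def)
  qed (use part in auto)
  moreover have "N' + S \<le> 2 * N'" using A(2) N'_ge by (simp add: M_def)
  moreover have "\<forall>f\<in>F. \<exists>s\<in>sumset (h - 1) Y'. n = f + s"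
    using A(4) sumset_mono[of "Y \<union> Z" Y' "h - 1"] by (fastforce simp: Y'_def)
  ultimately show ?thesis
    using N'_ge no_hole cov_Y cov_X
    by (intro exI[of _ n] exI[of _ N'] exI[of _ Y'] exI[of _ X'])
       (auto simp: S_def X'_def Y'_def)
qed

section \<open>The alternating construction\<close>

text \<open>Apart from \<open>{h..<2 * h}\<close>, everything up to some large \<open>N\<close> goes to \<open>Y\<close>, so that sums of two elements
(padded with zeros) already reach \<open>2 * N\<close>.\<close>

lemma initial_stage:
  assumes h: "2 \<le> h"
  shows "\<exists>N Y X. stage_inv h 0 N Y X \<and> 0 \<in> Y"
proof -
  define N where "N = blocklen h 0 + blocklen h 1 + 2 * h\<^sup>2 + 2 * h"
  define X where "X = {h..<2 * h}"
  define Y where "Y = {..N} - X"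
  have h_sq: "2 * h \<le> h\<^sup>2" using h by (simp add: power2_eq_square)
  have XN: "X \<subseteq> {..N}" by (auto simp: X_def N_def)
  have "stage_inv h 0 N Y X"
    unfolding stage_inv_def
  proof (intro conjI allI impI)
    show "Y \<union> X = {..N}" "Y \<inter> X = {}" using XN by (auto simp: Y_def)
    have "{..<h} \<subseteq> Y \<inter> {..<2 * h}" by (auto simp: Y_def X_def N_def)
    from card_mono[OF _ this] show "h \<le> card (Y \<inter> {..<2 * h})" by simp
    have "X \<inter> {..<2 * h} = {h..<2 * h}" by (auto simp: X_def)
    then show "h \<le> card (X \<inter> {..<2 * h})" by simp
    show "{N - blocklen h 0<..N} \<subseteq> Y" by (auto simp: Y_def X_def N_def)
    show "blocklen h (Suc 0) + 2 * h\<^sup>2 \<le> N" by (simp add: N_def)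
    fix z assume z: "N + 2 * h\<^sup>2 \<le> z \<and> z \<le> 2 * N"
    have "0 \<in> Y" using h by (auto simp: Y_def X_def)
    moreover have "N \<in> Y" by (auto simp: Y_def X_def N_def)
    moreover have "z - N \<in> Y" using z h_sq h by (auto simp: Y_def X_def)
    ultimately have "(h - 2) * 0 + (N + (z - N)) \<in> sumset h Y"
      using sumset_two_more[OF h] by blast
    then show "z \<in> sumset h Y" using z by simp
  qed
  moreover have "0 \<in> Y" using h by (auto simp: Y_def X_def)
  ultimately show ?thesis by blast
qed

definition stage_step :: "nat \<Rightarrow> nat \<Rightarrow> nat set \<Rightarrow> nat set \<Rightarrow> nat set \<Rightarrow> nat \<Rightarrow> nat \<Rightarrow> nat set \<Rightarrow> nat set \<Rightarrow> bool" where
  "stage_step h N Y X F n N' Y' X' \<longleftrightarrow> N < n \<and> n \<le> N' \<and> Y \<subseteq> Y' \<and> X \<subseteq> X' \<and>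
     n \<notin> sumset h (Y' - F) \<and> (\<forall>f\<in>F. \<exists>s\<in>sumset (h - 1) Y'. n = f + s) \<and>
     (\<forall>z. N + 2 * h\<^sup>2 < z \<and> z \<le> N' + 2 * h\<^sup>2 \<and> z \<noteq> n \<longrightarrow> z \<in> sumset h Y') \<and>
     (\<forall>z. N + 2 * h\<^sup>2 < z \<and> z \<le> N' + 2 * h\<^sup>2 \<longrightarrow> z \<in> sumset h X')"

text \<open>In even stages \<open>Y\<close> is the part of the future minimal basis, and its elements have to be critical
infinitely often, one at a time: the first component of \<open>prod_decode\<close> takes every value infinitely
often.  A value outside \<open>Y\<close> is replaced by \<open>0\<close>, which lies in the basis, because an empty set would
leave the hole unrepresented.  In odd stages \<open>Y\<close> is the part of the nonbasis.  Then all
elements up to \<open>t\<close> of the complement are critical at once.\<close>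

definition critical :: "nat \<Rightarrow> nat set \<Rightarrow> nat set \<Rightarrow> nat set" where
  "critical t Y X = (if even t then (let g = fst (prod_decode (t div 2)) in if g \<in> Y then {g} else {0})
                     else X \<inter> {..t})"

lemma critical_le: "critical t Y X \<subseteq> {..t}"
proof -
  have "fst (prod_decode (t div 2)) \<le> t div 2"
    using le_prod_encode_1[of "fst (prod_decode (t div 2))" "snd (prod_decode (t div 2))"] by simp
  then show ?thesis by (auto simp: critical_def Let_def)
qed

lemma stage_sequence:
  assumes h: "2 \<le> h"
  obtains Y N X n where
    "0 \<in> Y (0::nat)"
    "\<And>t. stage_inv h t (N t) (Y t) (X t)"
    "\<And>t. stage_step h (N t) (Y t) (X t) (critical t (Y t) (X t)) (n t) (N (Suc t)) (X (Suc t)) (Y (Suc t))"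
proof -
  define Inv where "Inv = (\<lambda>t (N, Y, X). stage_inv h t N Y X \<and> (t = 0 \<longrightarrow> 0 \<in> Y))"
  define Step where "Step = (\<lambda>t (N, Y, X) (N', Y', X'). \<exists>n. stage_step h N Y X (critical t Y X) n N' X' Y')"
  have "\<exists>s. \<forall>t. Inv t (s t) \<and> Step t (s t) (s (Suc t))"
  proof (rule dependent_nat_choice)
    show "\<exists>x. Inv 0 x" using initial_stage[OF h] by (auto simp: Inv_def)
  next
    fix x t assume "Inv t x"
    then obtain N Y X where x: "x = (N, Y, X)" "stage_inv h t N Y X"
      by (cases x) (auto simp: Inv_def)
    from exists_next_stage[OF h x(2) critical_le, of Y X]
    obtain n N' Y' X' where "stage_inv h (Suc t) N' X' Y'" "stage_step h N Y X (critical t Y X) n N' Y' X'"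
      unfolding stage_step_def by blast
    then show "\<exists>y. Inv (Suc t) y \<and> Step t x y"
      using x by (intro exI[of _ "(N', X', Y')"]) (auto simp: Inv_def Step_def)
  qed
  then obtain s where s: "\<And>t. Inv t (s t)" "\<And>t. Step t (s t) (s (Suc t))" by blast
  let ?N = "\<lambda>t. fst (s t)" and ?Y = "\<lambda>t. fst (snd (s t))" and ?X = "\<lambda>t. snd (snd (s t))"
  have "\<forall>t. \<exists>n. stage_step h (?N t) (?Y t) (?X t) (critical t (?Y t) (?X t)) n (?N (Suc t)) (?X (Suc t)) (?Y (Suc t))"
    using s(2) by (auto simp: Step_def split_beta)
  then obtain n where n: "\<And>t. stage_step h (?N t) (?Y t) (?X t) (critical t (?Y t) (?X t)) (n t) (?N (Suc t)) (?X (Suc t)) (?Y (Suc t))"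
    by metis
  have inv: "stage_inv h t (?N t) (?Y t) (?X t)" for t
    using s(1)[of t] by (simp add: Inv_def split_beta)
  have zero: "0 \<in> ?Y 0"
    using s(1)[of 0] by (simp add: Inv_def split_beta)
  show ?thesis by (rule that[of ?Y ?N ?X n, OF zero inv n])
qed

theorem theorem1p1:
  fixes h :: nat
  assumes "h \<ge> 2"
  shows "\<exists>A B :: nat set. A \<inter> B = {} \<and> A \<union> B = UNIV \<and>
           minimal_asymptotic_basis h A \<and> maximal_asymptotic_nonbasis h B"
proof (rule stage_sequence[OF assms])
  fix Y X :: "nat \<Rightarrow> nat set" and N n :: "nat \<Rightarrow> nat"
  assume zero: "0 \<in> Y 0" and inv: "\<And>t. stage_inv h t (N t) (Y t) (X t)"
    and step: "\<And>t. stage_step h (N t) (Y t) (X t) (critical t (Y t) (X t)) (n t) (N (Suc t)) (X (Suc t)) (Y (Suc t))"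
  define A where "A = (\<lambda>t. if even t then Y t else X t)"
  define B where "B = (\<lambda>t. if even t then X t else Y t)"
  have part: "A t \<union> B t = {..N t}" "A t \<inter> B t = {}" for t
    using inv[of t] by (auto simp: stage_inv_def A_def B_def)
  have mono: "A t \<subseteq> A (Suc t)" "B t \<subseteq> B (Suc t)" for t
    using step[of t] by (auto simp: stage_step_def A_def B_def)
  have A_mono: "A i \<subseteq> A j" and B_mono: "B i \<subseteq> B j" if "i \<le> j" for i j
    using lift_Suc_mono_le[of A, OF mono(1) that] lift_Suc_mono_le[of B, OF mono(2) that] by blast+
  have n_bounds: "N t < n t" "n t \<le> N (Suc t)" for t
    using step[of t] by (auto simp: stage_step_def)
  then have "strict_mono N" by (intro strict_mono_Suc_iff[THEN iffD2]) (meson less_le_trans)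
  then have N_ge: "t \<le> N t" for t by (rule strict_mono_imp_increasing)
  define A' where "A' = (\<Union>t. A t)"
  define B' where "B' = (\<Union>t. B t)"
  have sub: "A t \<subseteq> A'" "B t \<subseteq> B'" for t by (auto simp: A'_def B'_def)
  have disj: "A' \<inter> B' = {}"
  proof -
    have False if "x \<in> A i" "x \<in> B j" for x i j
      using that A_mono[of i "max i j"] B_mono[of j "max i j"] part(2)[of "max i j"] by auto
    then show ?thesis by (auto simp: A'_def B'_def)
  qed
  have un: "A' \<union> B' = UNIV"
  proof -
    have "x \<in> A' \<union> B'" for x
      using N_ge[of x] part(1)[of x] sub[of x] by blast
    then show ?thesis by blast
  qed
  have restr: "{x \<in> A'. x \<le> N t} \<subseteq> A t" "{x \<in> B'. x \<le> N t} \<subseteq> B t" for t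
    using part(1)[of t] sub[of t] disj by blast+
  have zeroA: "0 \<in> A t" for t
    using zero A_mono[of 0 t] by (auto simp: A_def)
  have tgt_odd: "critical t (Y t) (X t) = A t \<inter> {..t}" if "odd t" for t
    using that by (simp add: A_def critical_def)
  have covA: "z \<in> sumset h (A (Suc t))" if "N t + 2 * h\<^sup>2 < z" "z \<le> N (Suc t) + 2 * h\<^sup>2" "odd t \<or> z \<noteq> n t" for t z
    using step[of t] that by (auto simp: stage_step_def A_def)
  have covB: "z \<in> sumset h (B (Suc t))" if "N t + 2 * h\<^sup>2 < z" "z \<le> N (Suc t) + 2 * h\<^sup>2" "even t \<or> z \<noteq> n t" for t z
    using step[of t] that by (auto simp: stage_step_def B_def)
  have holeA: "n t \<notin> sumset h (A (Suc t) - critical t (A t) (B t))"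
      "\<forall>f\<in>critical t (A t) (B t). \<exists>s\<in>sumset (h - 1) (A (Suc t)). n t = f + s" if "even t" for t
    using step[of t] that by (auto simp: stage_step_def A_def B_def)
  have holeB: "n t \<notin> sumset h (B (Suc t) - A t \<inter> {..t})"
      "\<forall>f\<in>A t \<inter> {..t}. \<exists>s\<in>sumset (h - 1) (B (Suc t)). n t = f + s" if "odd t" for t
    using step[of t] tgt_odd[OF that] that by (auto simp: stage_step_def A_def B_def)
  have locate: "\<exists>t. N t + 2 * h\<^sup>2 < z \<and> z \<le> N (Suc t) + 2 * h\<^sup>2 \<and> t0 \<le> t" if "N t0 + 2 * h\<^sup>2 < z" for z t0
  proof -
    let ?P = "\<lambda>t. N t + 2 * h\<^sup>2 < z"
    define t where "t = Greatest ?P"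
    have bdd: "s \<le> z" if "?P s" for s using N_ge[of s] that by linarith
    have "?P t" unfolding t_def using GreatestI_nat[of ?P t0 z] that bdd by blast
    moreover have "t0 \<le> t" unfolding t_def using Greatest_le_nat[of ?P t0 z] that bdd by blast
    moreover have "\<not> ?P (Suc t)"
      using Greatest_le_nat[of ?P "Suc t" z] bdd unfolding t_def by fastforce
    ultimately show ?thesis by (intro exI[of _ t]) auto
  qed
  have cons: "f + s \<in> sumset h C" if "f \<in> C" "s \<in> sumset (h - 1) C" for f s and C :: "nat set"
    using sumset_SucI[OF that] assms by simp
  have crit_sub: "critical t (A t) (B t) \<subseteq> A t" if "even t" for t
    using that zeroA by (auto simp: critical_def Let_def)
  \<comment> \<open>the holes of even stages are represented with the help of their critical element\<close>
  have basisA: "asymptotic_basis h A'"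
    unfolding asymptotic_basis_def
  proof (intro exI allI impI)
    fix z assume "N 0 + 2 * h\<^sup>2 + 1 \<le> z"
    then obtain t where t: "N t + 2 * h\<^sup>2 < z" "z \<le> N (Suc t) + 2 * h\<^sup>2"
      using locate[of 0 z] by auto
    have "z \<in> sumset h (A (Suc t))"
    proof (cases "odd t \<or> z \<noteq> n t")
      case True
      then show ?thesis using covA t by blast
    next
      case False
      have "critical t (A t) (B t) \<noteq> {}" using False by (auto simp: critical_def Let_def)
      then obtain f s where "f \<in> A t" "s \<in> sumset (h - 1) (A (Suc t))" "n t = f + s"
        using holeA(2)[of t] crit_sub[of t] False by blast
      then show ?thesis using cons[of f "A (Suc t)" s] mono(1) False by auto
    qed
    then show "z \<in> sumset h A'" using sumset_mono[OF sub(1)] by blast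
  qed
  have minA: "\<not> asymptotic_basis h (A' - {a})" if "a \<in> A'" for a
  proof
    assume "asymptotic_basis h (A' - {a})"
    then obtain z0 where z0: "\<And>z. z0 \<le> z \<Longrightarrow> z \<in> sumset h (A' - {a})"
      unfolding asymptotic_basis_def by blast
    \<comment> \<open>an even stage beyond \<open>z0\<close> whose critical element is \<open>a\<close>\<close>
    define t where "t = 2 * prod_encode (a, max a z0)"
    have t: "even t" "fst (prod_decode (t div 2)) = a" by (simp_all add: t_def)
    have "max a z0 \<le> t" using le_prod_encode_2[of "max a z0" a] by (simp add: t_def)
    then have "a \<le> N t" "z0 \<le> n t" using N_ge[of t] n_bounds(1)[of t] by auto
    then have "a \<in> A t" using restr(1)[of t] that by blast
    then have crit: "critical t (A t) (B t) = {a}" using t by (simp add: critical_def)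
    have "n t \<in> sumset h (A' - {a})" using z0 \<open>z0 \<le> n t\<close> by blast
    then have "n t \<in> sumset h {x \<in> A' - {a}. x \<le> N (Suc t)}"
      using n_bounds(2)[of t] by (intro sumset_restrict[where y = 0]) auto
    moreover have "{x \<in> A' - {a}. x \<le> N (Suc t)} \<subseteq> A (Suc t) - {a}"
      using restr(1)[of "Suc t"] by blast
    ultimately have "n t \<in> sumset h (A (Suc t) - {a})"
      by (meson sumset_mono subsetD)
    then show False using holeA(1)[OF t(1)] crit by simp
  qed
  have nonB: "\<not> asymptotic_basis h B'"
  proof
    assume "asymptotic_basis h B'"
    then obtain z0 where z0: "\<And>z. z0 \<le> z \<Longrightarrow> z \<in> sumset h B'"
      unfolding asymptotic_basis_def by blast
    define t where "t = 2 * z0 + 1"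
    have "odd t" by (simp add: t_def)
    have "z0 \<le> n t" using N_ge[of t] n_bounds(1)[of t] by (simp add: t_def)
    then have "n t \<in> sumset h {x \<in> B'. x \<le> N (Suc t)}"
      using z0 n_bounds(2)[of t] by (intro sumset_restrict[where y = 0]) auto
    moreover have "{x \<in> B'. x \<le> N (Suc t)} \<subseteq> B (Suc t) - A t \<inter> {..t}"
      using restr(2)[of "Suc t"] disj sub(1)[of t] by blast
    ultimately have "n t \<in> sumset h (B (Suc t) - A t \<inter> {..t})"
      by (meson sumset_mono subsetD)
    then show False using holeB(1)[OF \<open>odd t\<close>] by simp
  qed
  \<comment> \<open>from stage \<open>b\<close> on, \<open>b\<close> is critical in every odd stage and repairs its hole\<close>
  have maxB: "asymptotic_basis h (B' \<union> {b})" if "b \<notin> B'" for b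
    unfolding asymptotic_basis_def
  proof (intro exI allI impI)
    fix z assume "N b + 2 * h\<^sup>2 + 1 \<le> z"
    then obtain t where t: "N t + 2 * h\<^sup>2 < z" "z \<le> N (Suc t) + 2 * h\<^sup>2" "b \<le> t"
      using locate[of b z] by auto
    have BB: "B (Suc t) \<subseteq> B' \<union> {b}" using sub(2) by blast
    show "z \<in> sumset h (B' \<union> {b})"
    proof (cases "even t \<or> z \<noteq> n t")
      case True
      then show ?thesis using covB t sumset_mono[OF BB] by blast
    next
      case False
      have "b \<in> A'" using that un by blast
      then have "b \<in> A t \<inter> {..t}" using restr(1)[of t] N_ge[of t] t(3) by auto
      then obtain s where "s \<in> sumset (h - 1) (B (Suc t))" "n t = b + s"
        using holeB(2)[of t] False by blast
      then show ?thesis using cons[of b "B' \<union> {b}" s] sumset_mono[OF BB] False by auto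
    qed
  qed
  show ?thesis
    unfolding minimal_asymptotic_basis_def maximal_asymptotic_nonbasis_def asymptotic_nonbasis_def
    using disj un basisA minA nonB maxB by (intro exI[of _ A'] exI[of _ B']) simp
qed

end
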